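(* Let $d\ge2$, let $\omega$ be a non-principal ultrafilter on $\mathbb{N}$, and let $(f_n)_{n\in\mathbb{N}}$ be a sequence of complex rational maps of degree $d$ degenerating in the moduli space $\mathrm{rat}_d(\mathbb{C})$. Then, as $l\ge 1$ and $(p_n)_{n\in\mathbb{N}}\in\mathrm{P}_l$ vary, there are at most $2d-2$ non-trivial multiplier scales. In particular, the total number of distinct multiplier scales is at most $2d-1$.
   Context: $\mathrm{Rat}_d(\mathbb{C})$ is the space of complex rational maps of degree $d$ and $\mathrm{rat}_d(\mathbb{C})=\mathrm{Rat}_d(\mathbb{C})/\mathrm{PGL}_2(\mathbb{C})$ is its quotient by Möbius conjugacy. A sequence $(f_n)$ degenerates in $\mathrm{rat}_d(\mathbb{C})$ if the conjugacy classes $[f_n]$ escape every compact subset of $\mathrm{rat}_d(\mathbb{C})$. A property holds $\omega$-almost surely if the set of $n$ where it holds belongs to $\omega$; $\lim_\omega$ is the limit along $\omega$. For $l\ge1$, $\mathrm{P}_l$ is the set of sequences $(p_n)_{n\in\mathbb{N}}$ where each $p_n\in\mathbb{P}^1(\mathbb{C})$ is a periodic point of $f_n$ whose period divides $l$, two sequences being identified if they are equal $\omega$-almost surely. For $(p_n)\in \mathrm{P}_l$ put $\lambda(f_n,p_n)=\frac1l\log^+|(f_n^l)'(p_n)|$ with $\log^+=\max\{\log,0\}$. A scale is an equivalence class of sequences $(\epsilon_n)_{n\in\mathbb{N}}\in(0,1]^{\mathbb{N}}$, where $(\epsilon_n)$ and $(\epsilon_n')$ are equivalent iff $\lim_\omega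 \epsilon_n/\epsilon_n'\in(0,\infty)$. The trivial scale is the class of the constant sequence $(1)$. The multiplier scale of $(p_n)\in \mathrm{P}_l$ is the scale represented by $\eta_{p,n}=\frac{1}{1+\lambda(f_n,p_n)}$. *)

theory Defs
  imports "HOL-Analysis.Analysis" "HOL-Computational_Algebra.Polynomial"
begin

subsection \<open>Ultrafilters\<close>

text \<open>
  A family \<open>\<omega>\<close> of subsets is encoded as a filter: \<open>{n. P n} \<in> \<omega>\<close> is \<open>eventually P \<omega>\<close>, and the
  limit along \<open>\<omega>\<close> is convergence with respect to that filter.
\<close>

definition ultrafilter :: "'a filter \<Rightarrow> bool" where
  "ultrafilter F \<longleftrightarrow> F \<noteq> bot \<and> (\<forall>P. eventually P F \<or> eventually (\<lambda>x. \<not> P x) F)"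

definition nonprincipal_ultrafilter :: "'a filter \<Rightarrow> bool" where
  "nonprincipal_ultrafilter F \<longleftrightarrow> ultrafilter F \<and> (\<forall>a. F \<noteq> principal {a})"

subsection \<open>Rational maps of the Riemann sphere\<close>

text \<open>\<open>P\<^sup>1(\<complex>) = \<complex> \<union> {\<infinity>}\<close>, with \<open>None\<close> as the point at infinity.\<close>

type_synonym riemann_sphere = "complex option"

text \<open>
  The map \<open>z \<mapsto> p(z) / q(z)\<close>, for coprime \<open>p\<close> and \<open>q\<close>. At infinity, the homogenized numerator and
  denominator take as values the coefficients in degree \<open>max (degree p) (degree q)\<close>.
\<close>

definition rat_map :: "complex poly \<Rightarrow> complex poly \<Rightarrow> riemann_sphere \<Rightarrow> riemann_sphere" where
  "rat_map p q z =
    (case z of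
       Some w \<Rightarrow> if poly q w = 0 then None else Some (poly p w / poly q w)
     | None \<Rightarrow> (let d = max (degree p) (degree q) in
                 if coeff q d = 0 then None else Some (coeff p d / coeff q d)))"

definition rat_pairs :: "nat \<Rightarrow> (complex poly \<times> complex poly) set" where
  "rat_pairs d = {(p, q). coprime p q \<and> max (degree p) (degree q) = d}"

definition Rat :: "nat \<Rightarrow> (riemann_sphere \<Rightarrow> riemann_sphere) set" where
  "Rat d = {rat_map p q | p q. (p, q) \<in> rat_pairs d}"

definition pgl2 :: "(riemann_sphere \<Rightarrow> riemann_sphere) set" where
  "pgl2 = {rat_map [:b, a:] [:d, c:] | a b c d. a * d - b * c \<noteq> 0}"

subsection \<open>The moduli space\<close>

definition quotient_topology :: "'a topology \<Rightarrow> ('a \<Rightarrow> 'b) \<Rightarrow> 'b topology" where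
  "quotient_topology X g =
    topology (\<lambda>U. U \<subseteq> g ` topspace X \<and> openin X {x \<in> topspace X. g x \<in> U})"

lemma openin_quotient_topology:
  "openin (quotient_topology X g) U \<longleftrightarrow>
     U \<subseteq> g ` topspace X \<and> openin X {x \<in> topspace X. g x \<in> U}"
proof -
  have "istopology (\<lambda>U. U \<subseteq> g ` topspace X \<and> openin X {x \<in> topspace X. g x \<in> U})"
    unfolding istopology_def
  proof (intro conjI allI impI)
    fix S T
    assume S: "S \<subseteq> g ` topspace X \<and> openin X {x \<in> topspace X. g x \<in> S}"
      and T: "T \<subseteq> g ` topspace X \<and> openin X {x \<in> topspace X. g x \<in> T}"
    then show "S \<inter> T \<subseteq> g ` topspace X" by auto
    have "{x \<in> topspace X. g x \<in> S \<inter> T}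
        = {x \<in> topspace X. g x \<in> S} \<inter> {x \<in> topspace X. g x \<in> T}" by auto
    then show "openin X {x \<in> topspace X. g x \<in> S \<inter> T}"
      using S T by (simp add: openin_Int)
  next
    fix K
    assume K: "\<forall>U\<in>K. U \<subseteq> g ` topspace X \<and> openin X {x \<in> topspace X. g x \<in> U}"
    then show "\<Union>K \<subseteq> g ` topspace X" by auto
    have "{x \<in> topspace X. g x \<in> \<Union>K} = (\<Union>U\<in>K. {x \<in> topspace X. g x \<in> U})" by auto
    then show "openin X {x \<in> topspace X. g x \<in> \<Union>K}"
      using K by (auto intro: openin_Union)
  qed
  then show ?thesis
    by (simp add: quotient_topology_def topology_inverse')
qed

lemma topspace_quotient_topology: "topspace (quotient_topology X g) = g ` topspace X"
proof -
  have "{x \<in> topspace X. g x \<in> g ` topspace X} = topspace X" by auto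
  then have "openin (quotient_topology X g) (g ` topspace X)"
    by (simp add: openin_quotient_topology)
  then show ?thesis
    by (metis openin_quotient_topology openin_subset openin_topspace subset_antisym)
qed

lemma quotient_map_quotient_topology: "quotient_map X (quotient_topology X g) g"
  by (auto simp: quotient_map_def topspace_quotient_topology openin_quotient_topology)

text \<open>
  Coprime pairs of degree \<open>d\<close> are topologized by their coefficients: all coefficients of degree
  greater than \<open>d\<close> vanish, so this is the topology of an open subset of \<open>\<complex>\<^bsup>2d+2\<^esup>\<close>. Two such pairs
  define the same map iff they are proportional, so \<open>Rat_topology d\<close> is the topology of
  \<open>Rat d\<close> as an open subset of the projective space of dimension \<open>2d+1\<close>.
\<close>

definition Rat_topology :: "nat \<Rightarrow> (riemann_sphere \<Rightarrow> riemann_sphere) topology" where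
  "Rat_topology d =
    quotient_topology
      (pullback_topology (rat_pairs d) (\<lambda>(p, q). (coeff p, coeff q)) euclidean)
      (\<lambda>(p, q). rat_map p q)"

lemma topspace_Rat_topology: "topspace (Rat_topology d) = Rat d"
  by (auto simp: Rat_topology_def topspace_quotient_topology topspace_pullback_topology Rat_def)

definition conj_class ::
  "(riemann_sphere \<Rightarrow> riemann_sphere) \<Rightarrow> (riemann_sphere \<Rightarrow> riemann_sphere) set" where
  "conj_class f = {m \<circ> f \<circ> inv m | m. m \<in> pgl2}"

definition moduli_topology ::
  "nat \<Rightarrow> (riemann_sphere \<Rightarrow> riemann_sphere) set topology" where
  "moduli_topology d = quotient_topology (Rat_topology d) conj_class"

lemma topspace_moduli_topology: "topspace (moduli_topology d) = conj_class ` Rat d"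
  by (simp add: moduli_topology_def topspace_quotient_topology topspace_Rat_topology)

definition degenerates :: "nat \<Rightarrow> (nat \<Rightarrow> riemann_sphere \<Rightarrow> riemann_sphere) \<Rightarrow> bool" where
  "degenerates d f \<longleftrightarrow>
    (\<forall>K. compactin (moduli_topology d) K \<longrightarrow>
         eventually (\<lambda>n. conj_class (f n) \<notin> K) sequentially)"

subsection \<open>Periodic points and multipliers\<close>

definition periodic_point :: "('a \<Rightarrow> 'a) \<Rightarrow> 'a \<Rightarrow> bool" where
  "periodic_point g x \<longleftrightarrow> (\<exists>k>0. (g ^^ k) x = x)"

definition period :: "('a \<Rightarrow> 'a) \<Rightarrow> 'a \<Rightarrow> nat" where
  "period g x = (LEAST k. k > 0 \<and> (g ^^ k) x = x)"

text \<open>The coordinate change \<open>z \<mapsto> 1 / z\<close>.\<close>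

definition sphere_inversion :: "riemann_sphere \<Rightarrow> riemann_sphere" where
  "sphere_inversion z =
    (case z of None \<Rightarrow> Some 0 | Some w \<Rightarrow> if w = 0 then None else Some (1 / w))"

text \<open>
  The expression of a self-map in the affine chart. The value \<open>0\<close> at poles is arbitrary; it is
  irrelevant for the derivative at a point whose image under a continuous map is finite.
\<close>

definition affine_part :: "(riemann_sphere \<Rightarrow> riemann_sphere) \<Rightarrow> complex \<Rightarrow> complex" where
  "affine_part g w = (case g (Some w) of None \<Rightarrow> 0 | Some v \<Rightarrow> v)"

text \<open>
  The derivative \<open>g'(x)\<close> at a fixed point \<open>x\<close> of \<open>g\<close>, computed in the coordinate \<open>1 / z\<close> if \<open>x = \<infinity>\<close>.
\<close>

definition fixed_point_deriv ::
  "(riemann_sphere \<Rightarrow> riemann_sphere) \<Rightarrow> riemann_sphere \<Rightarrow> complex" where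
  "fixed_point_deriv g x =
    (case x of
       Some w \<Rightarrow> deriv (affine_part g) w
     | None \<Rightarrow> deriv (affine_part (sphere_inversion \<circ> g \<circ> sphere_inversion)) 0)"

text \<open>Since \<open>ln 0 = 0\<close>, this gives \<open>log_plus 0 = 0\<close>, as it should be.\<close>

definition log_plus :: "real \<Rightarrow> real" where
  "log_plus x = max (ln x) 0"

definition multiplier_exponent ::
  "nat \<Rightarrow> (riemann_sphere \<Rightarrow> riemann_sphere) \<Rightarrow> riemann_sphere \<Rightarrow> real" where
  "multiplier_exponent l g x = 1 / real l * log_plus (norm (fixed_point_deriv (g ^^ l) x))"

definition periodic_seqs ::
  "(nat \<Rightarrow> riemann_sphere \<Rightarrow> riemann_sphere) \<Rightarrow> nat \<Rightarrow> (nat \<Rightarrow> riemann_sphere) set" where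
  "periodic_seqs f l = {p. \<forall>n. periodic_point (f n) (p n) \<and> period (f n) (p n) dvd l}"

definition ae_eq_rel ::
  "nat filter \<Rightarrow> (nat \<Rightarrow> riemann_sphere) set \<Rightarrow> ((nat \<Rightarrow> riemann_sphere) \<times> (nat \<Rightarrow> riemann_sphere)) set" where
  "ae_eq_rel \<omega> A = {(p, q). p \<in> A \<and> q \<in> A \<and> eventually (\<lambda>n. p n = q n) \<omega>}"

definition periodic_classes ::
  "nat filter \<Rightarrow> (nat \<Rightarrow> riemann_sphere \<Rightarrow> riemann_sphere) \<Rightarrow> nat \<Rightarrow> (nat \<Rightarrow> riemann_sphere) set set" where
  "periodic_classes \<omega> f l = periodic_seqs f l // ae_eq_rel \<omega> (periodic_seqs f l)"

subsection \<open>Scales\<close>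

definition scale_seqs :: "(nat \<Rightarrow> real) set" where
  "scale_seqs = {e. \<forall>n. e n \<in> {0<..1}}"

definition scale_rel :: "nat filter \<Rightarrow> ((nat \<Rightarrow> real) \<times> (nat \<Rightarrow> real)) set" where
  "scale_rel \<omega> = {(e, e'). e \<in> scale_seqs \<and> e' \<in> scale_seqs \<and>
                    (\<exists>c>0. ((\<lambda>n. e n / e' n) \<longlongrightarrow> c) \<omega>)}"

definition scale_of :: "nat filter \<Rightarrow> (nat \<Rightarrow> real) \<Rightarrow> (nat \<Rightarrow> real) set" where
  "scale_of \<omega> e = scale_rel \<omega> `` {e}"

definition trivial_scale :: "nat filter \<Rightarrow> (nat \<Rightarrow> real) set" where
  "trivial_scale \<omega> = scale_of \<omega> (\<lambda>_. 1)"

definition multiplier_scale_seq ::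
  "(nat \<Rightarrow> riemann_sphere \<Rightarrow> riemann_sphere) \<Rightarrow> nat \<Rightarrow> (nat \<Rightarrow> riemann_sphere) \<Rightarrow> nat \<Rightarrow> real" where
  "multiplier_scale_seq f l p n = 1 / (1 + multiplier_exponent l (f n) (p n))"

text \<open>
  The union is over the representatives of a class in \<open>P\<^sub>l\<close>; they all give the same scale, see
  \<open>multiplier_scale_class\<close> below.
\<close>

definition multiplier_scale ::
  "nat filter \<Rightarrow> (nat \<Rightarrow> riemann_sphere \<Rightarrow> riemann_sphere) \<Rightarrow> nat \<Rightarrow> (nat \<Rightarrow> riemann_sphere) set \<Rightarrow> (nat \<Rightarrow> real) set" where
  "multiplier_scale \<omega> f l P = (\<Union>p\<in>P. scale_of \<omega> (multiplier_scale_seq f l p))"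

definition multiplier_scales ::
  "nat filter \<Rightarrow> (nat \<Rightarrow> riemann_sphere \<Rightarrow> riemann_sphere) \<Rightarrow> (nat \<Rightarrow> real) set set" where
  "multiplier_scales \<omega> f = {multiplier_scale \<omega> f l P | l P. l \<ge> 1 \<and> P \<in> periodic_classes \<omega> f l}"

lemma scale_seqs_nonzero: "e \<in> scale_seqs \<Longrightarrow> e n \<noteq> 0"
proof -
  assume "e \<in> scale_seqs"
  then have "e n \<in> {0<..1}" unfolding scale_seqs_def by blast
  then show ?thesis by auto
qed

lemma multiplier_scale_seq_in: "multiplier_scale_seq f l p \<in> scale_seqs"
proof -
  have "multiplier_exponent l g x \<ge> 0" for g x
    by (simp add: multiplier_exponent_def log_plus_def)
  then show ?thesis
    by (simp add: scale_seqs_def multiplier_scale_seq_def add_pos_nonneg)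
qed

lemma equiv_ae_eq_rel: "equiv A (ae_eq_rel \<omega> A)"
proof (rule equivI)
  show "ae_eq_rel \<omega> A \<subseteq> A \<times> A" by (auto simp: ae_eq_rel_def)
  show "refl_on A (ae_eq_rel \<omega> A)" by (auto simp: refl_on_def ae_eq_rel_def)
  show "sym (ae_eq_rel \<omega> A)" by (auto simp: sym_def ae_eq_rel_def elim: eventually_mono)
  show "trans (ae_eq_rel \<omega> A)"
    by (auto simp: trans_def ae_eq_rel_def elim: eventually_elim2)
qed

lemma equiv_scale_rel: "equiv scale_seqs (scale_rel \<omega>)"
proof (rule equivI)
  show "scale_rel \<omega> \<subseteq> scale_seqs \<times> scale_seqs" by (auto simp: scale_rel_def)
  show "refl_on scale_seqs (scale_rel \<omega>)"
  proof (rule refl_onI)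
    fix e assume e: "e \<in> scale_seqs"
    then have "(\<lambda>n. e n / e n) = (\<lambda>_. 1)"
      by (simp add: scale_seqs_nonzero)
    then show "(e, e) \<in> scale_rel \<omega>"
      using e by (auto simp: scale_rel_def intro!: exI[of _ 1])
  qed
  show "sym (scale_rel \<omega>)"
  proof (rule symI)
    fix e e' assume "(e, e') \<in> scale_rel \<omega>"
    then obtain c where c: "e \<in> scale_seqs" "e' \<in> scale_seqs" "c > 0"
      and lim: "((\<lambda>n. e n / e' n) \<longlongrightarrow> c) \<omega>" by (auto simp: scale_rel_def)
    have "((\<lambda>n. e' n / e n) \<longlongrightarrow> inverse c) \<omega>"
      using tendsto_inverse[OF lim] c by simp
    then show "(e', e) \<in> scale_rel \<omega>"
      using c by (auto simp: scale_rel_def intro!: exI[of _ "inverse c"])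
  qed
  show "trans (scale_rel \<omega>)"
  proof (rule transI)
    fix e e' e'' assume "(e, e') \<in> scale_rel \<omega>" "(e', e'') \<in> scale_rel \<omega>"
    then obtain c c' where c: "e \<in> scale_seqs" "e' \<in> scale_seqs" "e'' \<in> scale_seqs" "c > 0" "c' > 0"
      and lim: "((\<lambda>n. e n / e' n) \<longlongrightarrow> c) \<omega>" "((\<lambda>n. e' n / e'' n) \<longlongrightarrow> c') \<omega>"
      by (auto simp: scale_rel_def)
    have "e' n \<noteq> 0" for n using c(2) by (rule scale_seqs_nonzero)
    then have "((\<lambda>n. e n / e'' n) \<longlongrightarrow> c * c') \<omega>"
      using tendsto_mult[OF lim] by simp
    then show "(e, e'') \<in> scale_rel \<omega>"
      using c by (auto simp: scale_rel_def intro!: exI[of _ "c * c'"])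
  qed
qed

lemma multiplier_scale_class:
  assumes "P \<in> periodic_classes \<omega> f l" "p \<in> P"
  shows "multiplier_scale \<omega> f l P = scale_of \<omega> (multiplier_scale_seq f l p)"
proof -
  let ?s = "multiplier_scale_seq f l"
  have "scale_of \<omega> (?s q) = scale_of \<omega> (?s p)" if "q \<in> P" for q
  proof -
    have "(q, p) \<in> ae_eq_rel \<omega> (periodic_seqs f l)"
      by (rule in_quotient_imp_in_rel[OF equiv_ae_eq_rel, of P])
        (use assms that in \<open>auto simp: periodic_classes_def\<close>)
    then have "eventually (\<lambda>n. q n = p n) \<omega>" by (simp add: ae_eq_rel_def)
    then have "eventually (\<lambda>n. ?s q n / ?s p n = 1) \<omega>"
    proof (rule eventually_mono)
      fix n assume "q n = p n"
      moreover have "?s p n \<noteq> 0"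
        using multiplier_scale_seq_in by (rule scale_seqs_nonzero)
      ultimately show "?s q n / ?s p n = 1" by (simp add: multiplier_scale_seq_def)
    qed
    then have "((\<lambda>n. ?s q n / ?s p n) \<longlongrightarrow> 1) \<omega>" by (rule tendsto_eventually)
    then have "(?s q, ?s p) \<in> scale_rel \<omega>"
      using multiplier_scale_seq_in by (auto simp: scale_rel_def intro!: exI[of _ 1])
    then show ?thesis
      unfolding scale_of_def by (rule equiv_class_eq[OF equiv_scale_rel])
  qed
  then show ?thesis using assms(2) unfolding multiplier_scale_def by blast
qed

end

theory Submission
  imports Defs "HOL-Library.Function_Algebras"
    "HOL-Computational_Algebra.Fundamental_Theorem_Algebra"
begin

text \<open>
  The proof is an Abhyankar-type inequality. After conjugation, a rational map of degree \<open>d\<close> has a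
  fixed point at infinity and depends on \<open>2d - 2\<close> parameters, and all multipliers are algebraic over
  the field generated by these parameters. Hence any \<open>2d - 1\<close> sequences of multipliers satisfy, almost
  surely, one nontrivial polynomial relation with constant coefficients. If their scales were
  nontrivial and pairwise distinct, then any two distinct monomials in the multipliers would
  have a ratio tending to \<open>0\<close> or to infinity along \<open>\<omega>\<close>, so the largest monomial of the relation could not
  be cancelled by the others.

  Algebraic dependence is obtained by counting: the monomials of degree at most \<open>M\<close> in each of \<open>m + 1\<close>
  unknowns number \<open>(M + 1)\<^bsup>m+1\<^esup>\<close>, while after clearing denominators they lie in a space of dimension
  \<open>O(M\<^bsup>m\<^esup>)\<close>.
\<close>

section \<open>Algebraic dependence of sequences by dimension counting\<close>

text \<open>The count \<open>2 * d - 2\<close> is that of the moduli space: \<open>2 * d + 2\<close>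
  coefficients, less 1 for a common factor and 3 for Moebius conjugation. The field behind the
  dimension count is the ultrapower of the complex numbers, sequences modulo almost sure equality.
  Linear algebra is done on the sequences themselves, where zero divisors exist and a relation may
  fail on a null set; transcendence degree is replaced by the exponent of polynomial growth of a
  filtration, which needs no basis and no choice of independent elements. The multipliers are
  rational functions of the parameters and of one further root each. An algebraic root multiplies
  dimensions by a constant and leaves the exponent unchanged.

  On the other side, the size of a sequence is measured by the logarithm of its modulus along
  \<omega>. A multiplier scale remembers this logarithm up to a factor with positive finite limit.
  Distinct scales therefore put the logarithms in distinct archimedean classes, which is stronger
  than rational independence: in comparing two monomials, one index outweighs all the
  others.\<close>

definition fscale :: "complex \<Rightarrow> ('a \<Rightarrow> complex) \<Rightarrow> 'a \<Rightarrow> complex" where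
  "fscale c x = (\<lambda>i. c * x i)"

interpretation fs: vector_space fscale
  by unfold_locales (auto simp: fscale_def fun_eq_iff algebra_simps)

lemma sum_fun_apply: "(\<Sum>i\<in>I. F i) n = (\<Sum>i\<in>I. F i n)" for F :: "'b \<Rightarrow> 'a \<Rightarrow> complex"
  by (induction I rule: infinite_finite_induct) auto

lemma power_fun_apply: "(x ^ k) n = x n ^ k" for x :: "'a \<Rightarrow> complex"
  by (induction k) auto

lemma prod_fun_apply: "(\<Prod>i\<in>I. F i) n = (\<Prod>i\<in>I. F i n)" for F :: "'b \<Rightarrow> 'a \<Rightarrow> complex"
  by (induction I rule: infinite_finite_induct) auto

lemma span_mult_image:
  fixes x z :: "'a \<Rightarrow> complex"
  assumes "x \<in> fs.span S" and "\<And>y. y \<in> S \<Longrightarrow> z * y \<in> fs.span S'"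
  shows "z * x \<in> fs.span S'"
  using assms(1)
proof (induction rule: fs.span_induct_alt)
  case base
  show ?case by (simp only: mult_zero_right fs.span_zero)
next
  case (step c y w)
  have "z * (fscale c y + w) = fscale c (z * y) + z * w"
    by (auto simp: fscale_def fun_eq_iff algebra_simps)
  moreover have "fscale c (z * y) + z * w \<in> fs.span S'"
    by (intro fs.span_add fs.span_scale assms(2) step)
  ultimately show ?case by (simp only:)
qed

text \<open>The coefficients belong to indices and not to vectors, because different monomials may
  coincide as functions. Such a coincidence is itself a relation; without one, more independent
  vectors than spanning ones would exist.\<close>

lemma nontrivial_relation:
  fixes F :: "'b \<Rightarrow> 'a \<Rightarrow> complex"
  assumes "finite I" "finite B" "F ` I \<subseteq> fs.span B" "card B < card I"
  obtains c where "\<exists>i\<in>I. c i \<noteq> 0" "(\<Sum>i\<in>I. fscale (c i) (F i)) = 0"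
proof (cases "inj_on F I")
  case True
  have "fs.dependent (F ` I)"
  proof (rule ccontr)
    assume "\<not> fs.dependent (F ` I)"
    then have "card (F ` I) \<le> card B"
      using fs.independent_span_bound assms(2,3) by blast
    then show False using assms(4) card_image[OF True] by simp
  qed
  then obtain u where u: "\<exists>v\<in>F ` I. u v \<noteq> 0" "(\<Sum>v\<in>F ` I. fscale (u v) v) = 0"
    using fs.dependent_finite[of "F ` I"] assms(1) by auto
  then show thesis
    using True by (intro that[of "\<lambda>i. u (F i)"]) (auto simp: sum.reindex)
next
  case False
  then obtain i j where ij: "i \<in> I" "j \<in> I" "i \<noteq> j" "F i = F j"
    by (auto simp: inj_on_def)
  let ?c = "\<lambda>k. if k = i then 1 else if k = j then - 1 else 0 :: complex"
  have "(\<Sum>k\<in>I. fscale (?c k) (F k)) = (\<Sum>k\<in>{i, j}. fscale (?c k) (F k))"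
    using ij assms(1) by (intro sum.mono_neutral_right) (auto simp: fscale_def fun_eq_iff)
  also have "\<dots> = 0"
    using ij by (auto simp: fscale_def fun_eq_iff)
  finally show thesis
    using ij by (intro that[of ?c]) auto
qed

text \<open>
  Think of \<open>T k\<close> as spanning the elements of degree at most \<open>k\<close> of a filtered algebra, of dimension
  \<open>O(k\<^bsup>m\<^esup>)\<close> in \<open>growth \<omega> m T\<close>. An element of \<open>filtered_ring T\<close> is one by which multiplication raises the
  degree by a bounded amount. The unit is only required to lie in \<open>T 0\<close> almost surely because
  algebraic relations hold only almost surely, and adjoining a root multiplies \<open>T\<close> by an indicator.
\<close>

definition filtered_ring :: "(nat \<Rightarrow> ('a \<Rightarrow> complex) set) \<Rightarrow> ('a \<Rightarrow> complex) set" where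
  "filtered_ring T = {x. \<exists>e. \<forall>k. \<forall>y\<in>T k. x * y \<in> fs.span (T (k + e))}"

definition growth ::
  "'a filter \<Rightarrow> nat \<Rightarrow> (nat \<Rightarrow> ('a \<Rightarrow> complex) set) \<Rightarrow> bool" where
  "growth \<omega> m T \<longleftrightarrow> mono T \<and> (\<exists>C. \<forall>k. finite (T k) \<and> card (T k) \<le> C * (k + 1) ^ m) \<and>
     (\<exists>u\<in>T 0. \<forall>\<^sub>F n in \<omega>. u n = 1)"

text \<open>A bound on the raise of degree survives sums and products but not inversion, so
  quotients are kept apart from \<open>filtered_ring T\<close>. Membership depends only on the class
  modulo almost sure equality (\<open>fractions_cong\<close>), which membership in
  \<open>filtered_ring T\<close> in general does not.\<close>

definition fractions ::
  "'a filter \<Rightarrow> (nat \<Rightarrow> ('a \<Rightarrow> complex) set) \<Rightarrow> ('a \<Rightarrow> complex) set" where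
  "fractions \<omega> T = {x. \<exists>g\<in>filtered_ring T. \<exists>h\<in>filtered_ring T. \<forall>\<^sub>F n in \<omega>. h n \<noteq> 0 \<and> h n * x n = g n}"

section \<open>Closure properties of the filtered ring and of its fractions\<close>

lemma growth_mono: "growth \<omega> m T \<Longrightarrow> mono T"
  by (simp add: growth_def)

lemma growth_weaken:
  assumes "growth \<omega> m T" "m \<le> m'"
  shows "growth \<omega> m' T"
proof -
  obtain C where C: "\<And>k. finite (T k)" "\<And>k. card (T k) \<le> C * (k + 1) ^ m"
    using assms(1) by (auto simp: growth_def)
  have "card (T k) \<le> C * (k + 1) ^ m'" for k
  proof -
    have "C * (k + 1) ^ m \<le> C * (k + 1) ^ m'"
      using assms(2) by (intro mult_left_mono power_increasing) auto
    then show ?thesis using C(2)[of k] by linarith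
  qed
  then show ?thesis using assms(1) C(1) by (auto simp: growth_def)
qed

lemma filtered_ringI:
  fixes x :: "'a \<Rightarrow> complex"
  shows "(\<And>k y. y \<in> T k \<Longrightarrow> x * y \<in> fs.span (T (k + e))) \<Longrightarrow> x \<in> filtered_ring T"
  by (auto simp: filtered_ring_def)

lemma filtered_ring_obtain:
  fixes x :: "'a \<Rightarrow> complex"
  assumes "x \<in> filtered_ring T"
  obtains e where "\<And>k y. y \<in> fs.span (T k) \<Longrightarrow> x * y \<in> fs.span (T (k + e))"
proof -
  obtain e where "\<forall>k. \<forall>y\<in>T k. x * y \<in> fs.span (T (k + e))"
    using assms by (auto simp: filtered_ring_def)
  then show thesis
    by (intro that[of e]) (auto intro: span_mult_image)
qed

lemma span_T_mono: "mono T \<Longrightarrow> k \<le> l \<Longrightarrow> x \<in> fs.span (T k) \<Longrightarrow> x \<in> fs.span (T l)"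
  using fs.span_mono[of "T k" "T l"] by (auto dest: monoD)

lemma filtered_ring_const: "(\<lambda>_. c) \<in> filtered_ring T"
proof (rule filtered_ringI[where e = 0])
  fix k y assume "y \<in> T k"
  moreover have "(\<lambda>_. c) * y = fscale c y"
    by (auto simp: fscale_def fun_eq_iff)
  ultimately show "(\<lambda>_. c) * y \<in> fs.span (T (k + 0))"
    by (auto intro: fs.span_scale fs.span_base)
qed

lemma filtered_ring_mult:
  fixes x y :: "'a \<Rightarrow> complex"
  assumes "x \<in> filtered_ring T" "y \<in> filtered_ring T"
  shows "x * y \<in> filtered_ring T"
proof -
  obtain a where a: "\<And>k w. w \<in> fs.span (T k) \<Longrightarrow> x * w \<in> fs.span (T (k + a))"
    using assms(1) filtered_ring_obtain by blast
  obtain b where b: "\<And>k w. w \<in> fs.span (T k) \<Longrightarrow> y * w \<in> fs.span (T (k + b))"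
    using assms(2) filtered_ring_obtain by blast
  show ?thesis
  proof (rule filtered_ringI[where e = "b + a"])
    fix k w assume "w \<in> T k"
    then have "x * (y * w) \<in> fs.span (T ((k + b) + a))"
      by (intro a b fs.span_base)
    then show "x * y * w \<in> fs.span (T (k + (b + a)))"
      by (simp add: mult.assoc add.assoc)
  qed
qed

lemma filtered_ring_add:
  fixes x y :: "'a \<Rightarrow> complex"
  assumes "mono T" "x \<in> filtered_ring T" "y \<in> filtered_ring T"
  shows "x + y \<in> filtered_ring T"
proof -
  obtain a where a: "\<And>k w. w \<in> fs.span (T k) \<Longrightarrow> x * w \<in> fs.span (T (k + a))"
    using assms(2) filtered_ring_obtain by blast
  obtain b where b: "\<And>k w. w \<in> fs.span (T k) \<Longrightarrow> y * w \<in> fs.span (T (k + b))"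
    using assms(3) filtered_ring_obtain by blast
  show ?thesis
  proof (rule filtered_ringI[where e = "a + b"])
    fix k w assume w: "w \<in> T k"
    have "x * w \<in> fs.span (T (k + (a + b)))"
      by (rule span_T_mono[OF assms(1) _ a[OF fs.span_base[OF w]]]) simp
    moreover have "y * w \<in> fs.span (T (k + (a + b)))"
      by (rule span_T_mono[OF assms(1) _ b[OF fs.span_base[OF w]]]) simp
    ultimately show "(x + y) * w \<in> fs.span (T (k + (a + b)))"
      by (simp add: distrib_right fs.span_add)
  qed
qed

lemma filtered_ring_sum:
  fixes F :: "'b \<Rightarrow> 'a \<Rightarrow> complex"
  assumes "mono T" "\<And>i. i \<in> I \<Longrightarrow> F i \<in> filtered_ring T"
  shows "(\<Sum>i\<in>I. F i) \<in> filtered_ring T"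
  using assms(2)
proof (induction I rule: infinite_finite_induct)
  case (insert i I)
  then have "F i + (\<Sum>i\<in>I. F i) \<in> filtered_ring T" by (intro filtered_ring_add[OF assms(1)]) auto
  then show ?case by (simp only: sum.insert[OF insert.hyps])
qed (use filtered_ring_const[of 0 T] in \<open>simp_all add: zero_fun_def\<close>)

lemma filtered_ring_mult_fun:
  fixes x y :: "'a \<Rightarrow> complex"
  shows "x \<in> filtered_ring T \<Longrightarrow> y \<in> filtered_ring T \<Longrightarrow> (\<lambda>n. x n * y n) \<in> filtered_ring T"
  using filtered_ring_mult[of x T y] by (simp add: times_fun_def)

lemma filtered_ring_add_fun:
  fixes x y :: "'a \<Rightarrow> complex"
  shows "mono T \<Longrightarrow> x \<in> filtered_ring T \<Longrightarrow> y \<in> filtered_ring T \<Longrightarrow> (\<lambda>n. x n + y n) \<in> filtered_ring T"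
  using filtered_ring_add[of T x y] by (simp add: plus_fun_def)

lemma filtered_ring_sum_fun:
  fixes F :: "'b \<Rightarrow> 'a \<Rightarrow> complex"
  assumes "mono T" "\<And>i. i \<in> I \<Longrightarrow> F i \<in> filtered_ring T"
  shows "(\<lambda>n. \<Sum>i\<in>I. F i n) \<in> filtered_ring T"
proof -
  have "(\<lambda>n. \<Sum>i\<in>I. F i n) = (\<Sum>i\<in>I. F i)" by (auto simp: fun_eq_iff sum_fun_apply)
  then show ?thesis using filtered_ring_sum[OF assms] by simp
qed

lemma fractionsI:
  "g \<in> filtered_ring T \<Longrightarrow> h \<in> filtered_ring T \<Longrightarrow> \<forall>\<^sub>F n in \<omega>. h n \<noteq> 0 \<and> h n * x n = g n \<Longrightarrow>
    x \<in> fractions \<omega> T"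
  by (auto simp: fractions_def)

lemma filtered_ring_subset_fractions: "filtered_ring T \<subseteq> fractions \<omega> T"
  by (auto intro!: fractionsI[OF _ filtered_ring_const[of 1]])

lemma fractions_mult:
  fixes x y :: "'a \<Rightarrow> complex"
  assumes "x \<in> fractions \<omega> T" "y \<in> fractions \<omega> T"
  shows "(\<lambda>n. x n * y n) \<in> fractions \<omega> T"
proof -
  obtain g h where 1: "g \<in> filtered_ring T" "h \<in> filtered_ring T"
    "\<forall>\<^sub>F n in \<omega>. h n \<noteq> 0 \<and> h n * x n = g n"
    using assms(1) by (auto simp: fractions_def)
  obtain g' h' where 2: "g' \<in> filtered_ring T" "h' \<in> filtered_ring T"
    "\<forall>\<^sub>F n in \<omega>. h' n \<noteq> 0 \<and> h' n * y n = g' n"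
    using assms(2) by (auto simp: fractions_def)
  have "\<forall>\<^sub>F n in \<omega>. (h * h') n \<noteq> 0 \<and> (h * h') n * (x n * y n) = (g * g') n"
    using 1(3) 2(3)
  proof eventually_elim
    case (elim n)
    then have *: "g' n = h' n * y n" "g n = h n * x n" by auto
    show ?case using elim by (simp add: *[symmetric]) (simp add: *)
  qed
  then show ?thesis
    using 1 2 by (intro fractionsI[of "g * g'" _ "h * h'"] filtered_ring_mult)
qed

lemma fractions_add:
  fixes x y :: "'a \<Rightarrow> complex"
  assumes "mono T" "x \<in> fractions \<omega> T" "y \<in> fractions \<omega> T"
  shows "(\<lambda>n. x n + y n) \<in> fractions \<omega> T"
proof -
  obtain g h where 1: "g \<in> filtered_ring T" "h \<in> filtered_ring T"
    "\<forall>\<^sub>F n in \<omega>. h n \<noteq> 0 \<and> h n * x n = g n"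
    using assms(2) by (auto simp: fractions_def)
  obtain g' h' where 2: "g' \<in> filtered_ring T" "h' \<in> filtered_ring T"
    "\<forall>\<^sub>F n in \<omega>. h' n \<noteq> 0 \<and> h' n * y n = g' n"
    using assms(3) by (auto simp: fractions_def)
  have "\<forall>\<^sub>F n in \<omega>. (h * h') n \<noteq> 0 \<and> (h * h') n * (x n + y n) = (g * h' + g' * h) n"
    using 1(3) 2(3)
  proof eventually_elim
    case (elim n)
    then have "g' n = h' n * y n" "g n = h n * x n" by auto
    then show ?case using elim by (simp add: algebra_simps)
  qed
  then show ?thesis
    using 1 2 assms(1)
    by (intro fractionsI[of "g * h' + g' * h" _ "h * h'"] filtered_ring_mult filtered_ring_add)
qed

lemma fractions_divide:
  fixes x y :: "'a \<Rightarrow> complex"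
  assumes "x \<in> fractions \<omega> T" "y \<in> fractions \<omega> T" "\<forall>\<^sub>F n in \<omega>. y n \<noteq> 0"
  shows "(\<lambda>n. x n / y n) \<in> fractions \<omega> T"
proof -
  obtain g h where 1: "g \<in> filtered_ring T" "h \<in> filtered_ring T"
    "\<forall>\<^sub>F n in \<omega>. h n \<noteq> 0 \<and> h n * x n = g n"
    using assms(1) by (auto simp: fractions_def)
  obtain g' h' where 2: "g' \<in> filtered_ring T" "h' \<in> filtered_ring T"
    "\<forall>\<^sub>F n in \<omega>. h' n \<noteq> 0 \<and> h' n * y n = g' n"
    using assms(2) by (auto simp: fractions_def)
  \<comment> \<open>The numerator \<open>g'\<close> can serve as a denominator:
    \<open>g' n = h' n * y n\<close> is nonzero where both factors are.\<close>
  have "\<forall>\<^sub>F n in \<omega>. (h * g') n \<noteq> 0 \<and> (h * g') n * (x n / y n) = (g * h') n"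
    using 1(3) 2(3) assms(3)
  proof eventually_elim
    case (elim n)
    then have *: "g' n = h' n * y n" "g n = h n * x n" by auto
    show ?case using elim by (simp add: *[symmetric])(simp add: * )
  qed
  then show ?thesis
    using 1 2 by (intro fractionsI[of "g * h'" _ "h * g'"] filtered_ring_mult)
qed

lemma fractions_sum:
  fixes F :: "'b \<Rightarrow> 'a \<Rightarrow> complex"
  assumes "mono T" "finite I" "\<And>i. i \<in> I \<Longrightarrow> F i \<in> fractions \<omega> T"
  shows "(\<lambda>n. \<Sum>i\<in>I. F i n) \<in> fractions \<omega> T"
  using assms(2,3)
proof (induction I rule: finite_induct)
  case empty
  then show ?case
    using filtered_ring_const[of 0 T] filtered_ring_subset_fractions[of T \<omega>] by auto
next
  case (insert i I)
  then show ?case by (simp add: fractions_add[OF assms(1)])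
qed

lemma fractions_power:
  fixes x :: "'a \<Rightarrow> complex"
  shows "x \<in> fractions \<omega> T \<Longrightarrow> (\<lambda>n. x n ^ k) \<in> fractions \<omega> T"
  using filtered_ring_const[of 1 T] filtered_ring_subset_fractions[of T \<omega>]
  by (induction k) (auto intro: fractions_mult)

lemma fractions_cong:
  assumes "x \<in> fractions \<omega> T" "\<forall>\<^sub>F n in \<omega>. x n = y n"
  shows "y \<in> fractions \<omega> T"
proof -
  obtain g h where 1: "g \<in> filtered_ring T" "h \<in> filtered_ring T"
    "\<forall>\<^sub>F n in \<omega>. h n \<noteq> 0 \<and> h n * x n = g n"
    using assms(1) by (auto simp: fractions_def)
  have "\<forall>\<^sub>F n in \<omega>. h n \<noteq> 0 \<and> h n * y n = g n"
    using 1(3) assms(2) by eventually_elim auto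
  then show ?thesis using 1 by (intro fractionsI)
qed

lemma fractions_mono: "filtered_ring T \<subseteq> filtered_ring T' \<Longrightarrow> fractions \<omega> T \<subseteq> fractions \<omega> T'"
  by (auto simp: fractions_def)

section \<open>Growth of the filtration when elements are adjoined\<close>

lemma growth_base: "growth \<omega> 0 (\<lambda>_. {1})"
  by (auto simp: growth_def mono_def)

text \<open>Treat \<open>t\<close> as a free variable: in degree \<open>k\<close> allow its powers
  up to \<open>k\<close>. This costs a factor \<open>k + 1\<close>, hence one more in the exponent.
  Old elements leave the power of \<open>t\<close> alone, and \<open>t\<close> itself raises the
  degree by 1.\<close>

lemma growth_adjoin_transcendental:
  fixes t :: "'a \<Rightarrow> complex"
  assumes "growth \<omega> m T"
  obtains T' where "growth \<omega> (Suc m) T'" "filtered_ring T \<subseteq> filtered_ring T'" "t \<in> filtered_ring T'"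
proof -
  obtain C where C: "\<And>k. finite (T k)" "\<And>k. card (T k) \<le> C * (k + 1) ^ m"
    using assms by (auto simp: growth_def)
  obtain u where u: "u \<in> T 0" "\<forall>\<^sub>F n in \<omega>. u n = 1"
    using assms by (auto simp: growth_def)
  have mT: "mono T" using assms by (simp add: growth_def)
  define T' where "T' = (\<lambda>k. (\<lambda>(y, j). y * t ^ j) ` (T k \<times> {..k}))"
  have mT': "mono T'"
  proof (rule monoI)
    fix k l :: nat assume kl: "k \<le> l"
    then have "T k \<subseteq> T l" using mT by (simp add: monoD)
    then have "T k \<times> {..k} \<subseteq> T l \<times> {..l}" using kl by auto
    then show "T' k \<subseteq> T' l" unfolding T'_def by (rule image_mono)
  qed
  have "card (T' k) \<le> C * (k + 1) ^ Suc m" for k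
  proof -
    have "card (T' k) \<le> card (T k \<times> {..k})"
      unfolding T'_def by (rule card_image_le) (simp add: C)
    also have "\<dots> = card (T k) * (k + 1)" by (simp add: card_cartesian_product)
    also have "\<dots> \<le> C * (k + 1) ^ m * (k + 1)" using C(2)[of k] by (rule mult_right_mono) simp
    finally show ?thesis by (simp add: algebra_simps)
  qed
  moreover have "finite (T' k)" for k using C(1) by (simp add: T'_def)
  moreover have "u \<in> T' 0" using u(1) by (auto simp: T'_def image_def)
  ultimately have "growth \<omega> (Suc m) T'"
    using mT' u(2) unfolding growth_def by blast
  moreover have "filtered_ring T \<subseteq> filtered_ring T'"
  proof
    fix x assume "x \<in> filtered_ring T"
    then obtain e where e: "\<And>k w. w \<in> fs.span (T k) \<Longrightarrow> x * w \<in> fs.span (T (k + e))"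
      using filtered_ring_obtain by blast
    show "x \<in> filtered_ring T'"
    proof (rule filtered_ringI[where e = e])
      fix k w assume "w \<in> T' k"
      then obtain y j where yj: "y \<in> T k" "j \<le> k" "w = y * t ^ j" by (auto simp: T'_def)
      have "x * y \<in> fs.span (T (k + e))" using yj by (intro e fs.span_base)
      then have "t ^ j * (x * y) \<in> fs.span (T' (k + e))"
      proof (rule span_mult_image)
        fix v assume "v \<in> T (k + e)"
        then have "v * t ^ j \<in> T' (k + e)"
          using yj unfolding T'_def by (intro image_eqI[of _ _ "(v, j)"]) auto
        then show "t ^ j * v \<in> fs.span (T' (k + e))" by (simp add: fs.span_base mult.commute)
      qed
      then show "x * w \<in> fs.span (T' (k + e))" using yj by (simp add: mult_ac)
    qed
  qed
  moreover have "t \<in> filtered_ring T'"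
  proof (rule filtered_ringI[where e = 1])
    fix k w assume "w \<in> T' k"
    then obtain y j where yj: "y \<in> T k" "j \<le> k" "w = y * t ^ j" by (auto simp: T'_def)
    have "T k \<subseteq> T (k + 1)" using mT by (simp add: monoD)
    then have "y * t ^ Suc j \<in> T' (k + 1)"
      using yj unfolding T'_def by (intro image_eqI[of _ _ "(y, Suc j)"]) auto
    moreover have "t * w = y * t ^ Suc j" using yj by (simp add: mult_ac)
    ultimately show "t * w \<in> fs.span (T' (k + 1))" by (simp add: fs.span_base)
  qed
  ultimately show thesis by (rule that)
qed

lemma growth_adjoin_list:
  "\<exists>T. growth \<omega> (length ts) T \<and> set ts \<subseteq> filtered_ring T"
proof (induction ts)
  case Nil
  then show ?case using growth_base by fastforce
next
  case (Cons t ts)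
  then obtain T where T: "growth \<omega> (length ts) T" "set ts \<subseteq> filtered_ring T" by blast
  obtain T' where "growth \<omega> (Suc (length ts)) T'" "filtered_ring T \<subseteq> filtered_ring T'"
    "t \<in> filtered_ring T'"
    using growth_adjoin_transcendental[OF T(1)] by blast
  then show ?case using T by (intro exI[of _ T']) auto
qed

text \<open>Powers of \<open>z\<close> below \<open>D\<close> suffice, since the relation reduces
  higher ones; dimensions grow only by the factor \<open>D\<close>. Reducing \<open>z ^ D\<close>
  requires the factor \<open>a D\<close> in front, so it is \<open>a D * z\<close> that enters the
  filtered ring, and \<open>z\<close> becomes a fraction.\<close>

lemma growth_adjoin_algebraic:
  fixes z :: "'a \<Rightarrow> complex" and a :: "nat \<Rightarrow> 'a \<Rightarrow> complex"
  assumes "growth \<omega> m T" "D > 0" and a: "\<And>j. j \<le> D \<Longrightarrow> a j \<in> filtered_ring T"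
    and rel: "\<forall>\<^sub>F n in \<omega>. (\<Sum>j\<le>D. a j n * z n ^ j) = 0" and nz: "\<forall>\<^sub>F n in \<omega>. a D n \<noteq> 0"
  obtains T' where "growth \<omega> m T'" "filtered_ring T \<subseteq> filtered_ring T'" "z \<in> fractions \<omega> T'"
proof -
  obtain C where C: "\<And>k. finite (T k)" "\<And>k. card (T k) \<le> C * (k + 1) ^ m"
    using assms by (auto simp: growth_def)
  obtain u where u: "u \<in> T 0" "\<forall>\<^sub>F n in \<omega>. u n = 1"
    using assms by (auto simp: growth_def)
  have mT: "mono T" using assms by (simp add: growth_def)
  \<comment> \<open>The indicator of the set where the relation holds. Multiplying the new spaces by
    it turns the almost sure relation into an identity at every index.\<close>
  define i where "i = (\<lambda>n. if (\<Sum>j\<le>D. a j n * z n ^ j) = 0 then 1 else 0 :: complex)"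
  have ev_i: "\<forall>\<^sub>F n in \<omega>. i n = 1"
    using rel by eventually_elim (simp add: i_def)
  define T' where "T' = (\<lambda>k. (\<lambda>(y, j). i * y * z ^ j) ` (T k \<times> {..<D}))"
  have T'I: "y \<in> T k \<Longrightarrow> j < D \<Longrightarrow> i * y * z ^ j \<in> T' k" for y j k
    unfolding T'_def by (rule image_eqI[of _ _ "(y, j)"]) auto
  have span': "i * y * z ^ j \<in> fs.span (T' k)" if "y \<in> fs.span (T k)" "j < D" for y j k
  proof -
    have "(i * z ^ j) * y \<in> fs.span (T' k)"
      using that(1)
    proof (rule span_mult_image)
      fix v assume "v \<in> T k"
      then show "i * z ^ j * v \<in> fs.span (T' k)"
        using T'I[of v k j] that(2) by (simp add: mult_ac fs.span_base)
    qed
    then show ?thesis by (simp add: mult_ac)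
  qed
  have mT': "mono T'"
  proof (rule monoI)
    fix k l :: nat assume "k \<le> l"
    then have "T k \<subseteq> T l" using mT by (simp add: monoD)
    then show "T' k \<subseteq> T' l" unfolding T'_def by (intro image_mono) auto
  qed
  have "card (T' k) \<le> (C * D) * (k + 1) ^ m" for k
  proof -
    have "card (T' k) \<le> card (T k \<times> {..<D})"
      unfolding T'_def by (rule card_image_le) (simp add: C)
    also have "\<dots> = card (T k) * D" by (simp add: card_cartesian_product)
    also have "\<dots> \<le> C * (k + 1) ^ m * D" using C(2)[of k] by (rule mult_right_mono) simp
    finally show ?thesis by (simp add: algebra_simps)
  qed
  moreover have "finite (T' k)" for k using C(1) by (simp add: T'_def)
  moreover have "i * u \<in> T' 0"
    using T'I[OF u(1) assms(2)] by simp
  moreover have "\<forall>\<^sub>F n in \<omega>. (i * u) n = 1"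
    using u(2) ev_i by eventually_elim simp
  ultimately have G: "growth \<omega> m T'"
    using mT' unfolding growth_def by blast
  have sub: "filtered_ring T \<subseteq> filtered_ring T'"
  proof
    fix x assume "x \<in> filtered_ring T"
    then obtain e where e: "\<And>k w. w \<in> fs.span (T k) \<Longrightarrow> x * w \<in> fs.span (T (k + e))"
      using filtered_ring_obtain by blast
    show "x \<in> filtered_ring T'"
    proof (rule filtered_ringI[where e = e])
      fix k w assume "w \<in> T' k"
      then obtain y j where yj: "y \<in> T k" "j < D" "w = i * y * z ^ j" by (auto simp: T'_def)
      have "x * y \<in> fs.span (T (k + e))" using yj by (intro e fs.span_base)
      then have "i * (x * y) * z ^ j \<in> fs.span (T' (k + e))" using yj(2) by (rule span')
      then show "x * w \<in> fs.span (T' (k + e))" using yj by (simp add: mult_ac)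
    qed
  qed
  have "\<forall>j. \<exists>e. j \<le> D \<longrightarrow> (\<forall>k w. w \<in> fs.span (T k) \<longrightarrow> a j * w \<in> fs.span (T (k + e)))"
    using filtered_ring_obtain[OF a] by blast
  from choice[OF this] obtain e where
    e: "\<And>j k w. j \<le> D \<Longrightarrow> w \<in> fs.span (T k) \<Longrightarrow> a j * w \<in> fs.span (T (k + e j))"
    by blast
  \<comment> \<open>A degree bound that serves all coefficients at once.\<close>
  define E where "E = (\<Sum>j\<le>D. e j)"
  have eE: "e j \<le> E" if "j \<le> D" for j
    unfolding E_def using that by (intro member_le_sum) auto
  have aE: "a j * w \<in> fs.span (T (k + E))" if "j \<le> D" "w \<in> T k" for j k w
    using eE[OF that(1)]
    by (intro span_T_mono[OF mT _ e[OF that(1) fs.span_base[OF that(2)]]]) simp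
  have az: "a D * z \<in> filtered_ring T'"
  proof (rule filtered_ringI[where e = E])
    fix k w assume "w \<in> T' k"
    then obtain y j where yj: "y \<in> T k" "j < D" "w = i * y * z ^ j" by (auto simp: T'_def)
    show "a D * z * w \<in> fs.span (T' (k + E))"
    proof (cases "Suc j < D")
      case True
      have "i * (a D * y) * z ^ Suc j \<in> fs.span (T' (k + E))"
        using aE[of D y k] yj True by (intro span') auto
      then show ?thesis using yj by (simp add: mult_ac)
    next
      case False
      then have D: "D = Suc j" using yj by simp
      \<comment> \<open>Only here does the product contain \<open>z ^ D\<close>; the relation
        replaces it by lower powers. Where the relation fails, both sides vanish because
        \<open>i\<close> does.\<close>
      have "a D * z * w = (\<Sum>r<D. fscale (- 1) (i * (a r * y) * z ^ r))"
      proof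
        fix n
        show "(a D * z * w) n = (\<Sum>r<D. fscale (- 1) (i * (a r * y) * z ^ r)) n"
        proof (cases "i n = 0")
          case True
          then show ?thesis using yj by (simp add: sum_fun_apply fscale_def)
        next
          case False
          then have "(\<Sum>r\<le>D. a r n * z n ^ r) = 0" by (auto simp: i_def split: if_splits)
          then have *: "a D n * z n ^ D = - (\<Sum>r<D. a r n * z n ^ r)"
            by (simp add: lessThan_Suc_atMost[symmetric] add_eq_0_iff)
          have "(a D * z * w) n = i n * y n * (a D n * z n ^ D)"
            using yj D by (simp add: power_fun_apply)
          also have "\<dots> = (\<Sum>r<D. - (i n * (a r n * y n) * z n ^ r))"
            unfolding * by (simp add: sum_distrib_left sum_negf algebra_simps)
          finally show ?thesis by (simp add: sum_fun_apply fscale_def power_fun_apply)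
        qed
      qed
      moreover have "(\<Sum>r<D. fscale (- 1) (i * (a r * y) * z ^ r)) \<in> fs.span (T' (k + E))"
      proof (rule fs.span_sum)
        fix r assume r: "r \<in> {..<D}"
        then have "i * (a r * y) * z ^ r \<in> fs.span (T' (k + E))"
          using aE[of r y k] yj by (intro span') auto
        then show "fscale (- 1) (i * (a r * y) * z ^ r) \<in> fs.span (T' (k + E))"
          by (rule fs.span_scale)
      qed
      ultimately show ?thesis by simp
    qed
  qed
  have "z \<in> fractions \<omega> T'"
    by (rule fractionsI[of "a D * z" _ "a D"]) (use az a sub nz in auto)
  with G sub show thesis by (rule that)
qed

text \<open>There are \<open>m + 1\<close> sequences against the growth exponent \<open>m\<close>.
  Multiplying every monomial by the same power of all denominators puts it into one space of the
  filtration, where the monomials outnumber the dimension. The resulting relation can be divided by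
  this common factor, which is almost surely nonzero.\<close>

lemma algebraic_dependence:
  fixes x :: "nat \<Rightarrow> 'a \<Rightarrow> complex"
  assumes G: "growth \<omega> m T" and x: "\<And>i. i \<le> m \<Longrightarrow> x i \<in> fractions \<omega> T"
  obtains M c where "\<exists>\<alpha>\<in>PiE {..m} (\<lambda>_. {..M}). c \<alpha> \<noteq> 0"
    "\<forall>\<^sub>F n in \<omega>. (\<Sum>\<alpha>\<in>PiE {..m} (\<lambda>_. {..M}). c \<alpha> * (\<Prod>i\<le>m. x i n ^ \<alpha> i)) = 0"
proof -
  obtain C where C: "\<And>k. finite (T k)" "\<And>k. card (T k) \<le> C * (k + 1) ^ m"
    using G by (auto simp: growth_def)
  obtain u where u: "u \<in> T 0" "\<forall>\<^sub>F n in \<omega>. u n = 1"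
    using G by (auto simp: growth_def)
  have mT: "mono T" using G by (simp add: growth_def)
  have "\<forall>i. \<exists>g h. i \<le> m \<longrightarrow> g \<in> filtered_ring T \<and> h \<in> filtered_ring T \<and>
      (\<forall>\<^sub>F n in \<omega>. h n \<noteq> 0 \<and> h n * x i n = g n)"
    using x unfolding fractions_def by blast
  from choice[OF this] obtain g where "\<forall>i. \<exists>h. i \<le> m \<longrightarrow> g i \<in> filtered_ring T \<and> h \<in> filtered_ring T \<and>
      (\<forall>\<^sub>F n in \<omega>. h n \<noteq> 0 \<and> h n * x i n = g i n)" by blast
  from choice[OF this] obtain h where gh: "\<And>i. i \<le> m \<Longrightarrow> g i \<in> filtered_ring T"
    "\<And>i. i \<le> m \<Longrightarrow> h i \<in> filtered_ring T"
    "\<And>i. i \<le> m \<Longrightarrow> \<forall>\<^sub>F n in \<omega>. h i n \<noteq> 0 \<and> h i n * x i n = g i n"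
    by blast
  have "\<exists>e. y \<in> filtered_ring T \<longrightarrow> (\<forall>k w. w \<in> fs.span (T k) \<longrightarrow> y * w \<in> fs.span (T (k + e)))" for y
    using filtered_ring_obtain[of y T] by blast
  then have "\<forall>y. \<exists>e. y \<in> filtered_ring T \<longrightarrow> (\<forall>k w. w \<in> fs.span (T k) \<longrightarrow> y * w \<in> fs.span (T (k + e)))"
    by blast
  from choice[OF this] obtain e where
    e: "\<And>y k w. y \<in> filtered_ring T \<Longrightarrow> w \<in> fs.span (T k) \<Longrightarrow> y * w \<in> fs.span (T (k + e y))"
    by blast
  define E where "E = (\<Sum>i\<le>m. e (g i) + e (h i))"
  have eE: "e (g i) \<le> E" "e (h i) \<le> E" if "i \<le> m" for i
    unfolding E_def using that member_le_sum[of i "{..m}" "\<lambda>i. e (g i) + e (h i)"] by auto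
  have step: "g i * w \<in> fs.span (T (k + E))" "h i * w \<in> fs.span (T (k + E))"
    if "i \<le> m" "w \<in> fs.span (T k)" for i k w
    using span_T_mono[OF mT _ e[OF gh(1)[OF that(1)] that(2)], of "k + E"]
      span_T_mono[OF mT _ e[OF gh(2)[OF that(1)] that(2)], of "k + E"] eE[OF that(1)]
    by (meson add_left_mono)+
  have gpow: "g i ^ r * w \<in> fs.span (T (k + r * E))" if "i \<le> m" "w \<in> fs.span (T k)" for i k w r
  proof (induction r)
    case (Suc r)
    then show ?case using step(1)[OF that(1) Suc] by (simp add: mult_ac add_ac del: times_fun_apply)
  qed (use that in simp)
  have hpow: "h i ^ r * w \<in> fs.span (T (k + r * E))" if "i \<le> m" "w \<in> fs.span (T k)" for i k w r
  proof (induction r)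
    case (Suc r)
    then show ?case using step(2)[OF that(1) Suc] by (simp add: mult_ac add_ac del: times_fun_apply)
  qed (use that in simp)
  \<comment> \<open>chosen so that \<open>C (E (m + 1) M + 1)\<^bsup>m\<^esup> < (M + 1)\<^bsup>m+1\<^esup>\<close>\<close>
  define M where "M = C * (E * (m + 1) + 1) ^ m"
  define I where "I = PiE {..m} (\<lambda>_. {..M})"
  \<comment> \<open>The monomial with exponents \<alpha> times the common denominator, the product
    of all \<open>h i ^ M\<close>. The factor \<open>u\<close> stands for the unit and starts the
    product inside \<open>T 0\<close>.\<close>
  define F where "F = (\<lambda>\<alpha>. (\<Prod>i\<le>m. g i ^ \<alpha> i * h i ^ (M - \<alpha> i)) * u)"
  have finI: "finite I" unfolding I_def by (intro finite_PiE) auto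
  have cardI: "card I = (M + 1) ^ (m + 1)"
    unfolding I_def by (simp add: card_PiE)
  have Fspan: "F \<alpha> \<in> fs.span (T (M * E * (m + 1)))" if "\<alpha> \<in> I" for \<alpha>
  proof -
    have "(\<Prod>i\<in>J. g i ^ \<alpha> i * h i ^ (M - \<alpha> i)) * u \<in> fs.span (T (M * E * card J))"
      if "J \<subseteq> {..m}" "finite J" for J
      using that(2,1)
    proof (induction J rule: finite_induct)
      case empty
      then show ?case using u(1) by (simp add: fs.span_base)
    next
      case (insert i J)
      then have i: "i \<le> m" by simp
      then have \<alpha>i: "\<alpha> i \<le> M" using \<open>\<alpha> \<in> I\<close> by (auto simp: I_def PiE_def Pi_def)
      let ?P = "(\<Prod>i\<in>J. g i ^ \<alpha> i * h i ^ (M - \<alpha> i)) * u"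
      have "?P \<in> fs.span (T (M * E * card J))" using insert.IH insert.prems by blast
      then have "g i ^ \<alpha> i * (h i ^ (M - \<alpha> i) * ?P)
          \<in> fs.span (T (M * E * card J + (M - \<alpha> i) * E + \<alpha> i * E))"
        by (intro gpow hpow i)
      \<comment> \<open>Each index contributes exactly \<open>M\<close> factors of degree at most
        \<open>E\<close>, whatever \<alpha> is, so all products land in the same space.\<close>
      moreover have "M * E * card J + (M - \<alpha> i) * E + \<alpha> i * E = M * E * card (insert i J)"
      proof -
        have "(M - \<alpha> i) * E + \<alpha> i * E = M * E" using \<alpha>i by (simp flip: add_mult_distrib)
        then show ?thesis using insert.hyps by simp
      qed
      moreover have "(\<Prod>i\<in>insert i J. g i ^ \<alpha> i * h i ^ (M - \<alpha> i)) * u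
          = g i ^ \<alpha> i * (h i ^ (M - \<alpha> i) * ?P)"
        by (simp only: prod.insert[OF insert.hyps] mult_ac)
      ultimately show ?case by (simp only:)
    qed
    from this[of "{..m}"] show ?thesis by (simp add: F_def)
  qed
  have "card (T (M * E * (m + 1))) \<le> C * (M * E * (m + 1) + 1) ^ m" by (rule C)
  also have "\<dots> \<le> C * ((M + 1) * (E * (m + 1) + 1)) ^ m"
    by (intro mult_left_mono power_mono) (auto simp: algebra_simps)
  also have "\<dots> = C * (E * (m + 1) + 1) ^ m * (M + 1) ^ m"
    by (simp only: power_mult_distrib mult_ac)
  also have "\<dots> = M * (M + 1) ^ m" by (simp only: M_def)
  also have "\<dots> < (M + 1) ^ (m + 1)" by simp
  finally have card_less: "card (T (M * E * (m + 1))) < card I" using cardI by simp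
  obtain c where c: "\<exists>\<alpha>\<in>I. c \<alpha> \<noteq> 0" "(\<Sum>\<alpha>\<in>I. fscale (c \<alpha>) (F \<alpha>)) = 0"
    using nontrivial_relation[OF finI C(1) _ card_less, of F] Fspan by blast
  have "\<forall>\<^sub>F n in \<omega>. \<forall>i\<in>{..m}. h i n \<noteq> 0 \<and> h i n * x i n = g i n"
    using gh(3) by (intro eventually_ball_finite) auto
  then have "\<forall>\<^sub>F n in \<omega>. (\<Sum>\<alpha>\<in>I. c \<alpha> * (\<Prod>i\<le>m. x i n ^ \<alpha> i)) = 0"
    using u(2)
  proof eventually_elim
    case (elim n)
    let ?H = "\<Prod>i\<le>m. h i n ^ M"
    have "F \<alpha> n = ?H * (\<Prod>i\<le>m. x i n ^ \<alpha> i)" if "\<alpha> \<in> I" for \<alpha>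
    proof -
      have "g i n ^ \<alpha> i * h i n ^ (M - \<alpha> i) = h i n ^ M * x i n ^ \<alpha> i" if "i \<le> m" for i
      proof -
        have "\<alpha> i \<le> M" using \<open>\<alpha> \<in> I\<close> \<open>i \<le> m\<close> by (auto simp: I_def PiE_def Pi_def)
        then have "h i n ^ M = h i n ^ \<alpha> i * h i n ^ (M - \<alpha> i)" by (simp flip: power_add)
        moreover have "g i n = h i n * x i n" using elim that by auto
        ultimately show ?thesis by (simp add: power_mult_distrib mult_ac)
      qed
      then show ?thesis
        using elim by (simp add: F_def prod_fun_apply power_fun_apply flip: prod.distrib)
    qed
    then have "(\<Sum>\<alpha>\<in>I. c \<alpha> * F \<alpha> n) = ?H * (\<Sum>\<alpha>\<in>I. c \<alpha> * (\<Prod>i\<le>m. x i n ^ \<alpha> i))"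
      by (simp add: sum_distrib_left mult_ac)
    moreover have "(\<Sum>\<alpha>\<in>I. c \<alpha> * F \<alpha> n) = 0"
      using fun_cong[OF c(2), of n] by (simp add: sum_fun_apply fscale_def)
    moreover have "?H \<noteq> 0" using elim by simp
    ultimately show ?case by simp
  qed
  then show thesis using c(1) that[of M c] unfolding I_def by blast
qed

section \<open>Rational maps in homogeneous coordinates\<close>

text \<open>The point with homogeneous coordinates \<open>[x : y]\<close>; \<open>proj 0 0\<close> is junk.\<close>

definition proj :: "complex \<Rightarrow> complex \<Rightarrow> riemann_sphere" where
  "proj x y = (if y = 0 then None else Some (x / y))"

definition hform :: "nat \<Rightarrow> complex poly \<Rightarrow> complex \<Rightarrow> complex \<Rightarrow> complex" where
  "hform d p x y = (\<Sum>i\<le>d. coeff p i * x ^ i * y ^ (d - i))"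

text \<open>Having no common zero on the projective line encodes coprimality and degree
  \<open>d\<close> at once: a zero at infinity means that both coefficients of degree
  \<open>d\<close> vanish. Unlike degrees, this condition passes through coordinate changes
  directly.\<close>

definition nondegenerate :: "nat \<Rightarrow> complex poly \<Rightarrow> complex poly \<Rightarrow> bool" where
  "nondegenerate d p q \<longleftrightarrow> degree p \<le> d \<and> degree q \<le> d \<and>
     (\<forall>x y. (x, y) \<noteq> (0, 0) \<longrightarrow> hform d p x y \<noteq> 0 \<or> hform d q x y \<noteq> 0)"

text \<open>In contrast to \<open>rat_map\<close>, the degree is a parameter, so that a conjugation
  does not have to recompute the maximum of two degrees.\<close>

definition rmap :: "nat \<Rightarrow> complex poly \<Rightarrow> complex poly \<Rightarrow> riemann_sphere \<Rightarrow> riemann_sphere" where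
  "rmap d p q z = (case z of None \<Rightarrow> proj (coeff p d) (coeff q d) | Some w \<Rightarrow> proj (poly p w) (poly q w))"

lemma proj_scale: "c \<noteq> 0 \<Longrightarrow> proj (c * x) (c * y) = proj x y"
  by (simp add: proj_def)

lemma proj_cases:
  obtains x y where "z = proj x y" "(x, y) \<noteq> (0, 0)"
proof (cases z)
  case None
  then show thesis using that[of 1 0] by (simp add: proj_def)
next
  case (Some w)
  then show thesis using that[of w 1] by (simp add: proj_def)
qed

lemma hform_one:
  assumes "degree p \<le> d"
  shows "hform d p w 1 = poly p w"
proof -
  have "(\<Sum>i\<le>d. coeff p i * w ^ i) = (\<Sum>i\<le>degree p. coeff p i * w ^ i)"
    using assms by (intro sum.mono_neutral_right) (auto simp: coeff_eq_0)
  then show ?thesis by (simp add: hform_def poly_altdef)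
qed

lemma hform_zero: "hform d p x 0 = coeff p d * x ^ d"
proof -
  have "hform d p x 0 = (\<Sum>i\<in>{d}. coeff p i * x ^ i * 0 ^ (d - i))"
    unfolding hform_def by (intro sum.mono_neutral_right) auto
  then show ?thesis by simp
qed

lemma hform_scale: "hform d p (c * x) (c * y) = c ^ d * hform d p x y"
  unfolding hform_def sum_distrib_left
proof (intro sum.cong refl)
  fix i assume "i \<in> {..d}"
  then have "c ^ d = c ^ i * c ^ (d - i)" by (simp flip: power_add)
  then show "coeff p i * (c * x) ^ i * (c * y) ^ (d - i) = c ^ d * (coeff p i * x ^ i * y ^ (d - i))"
    by (simp add: power_mult_distrib)
qed

lemma hform_diff: "hform d (p - q) x y = hform d p x y - hform d q x y"
  by (simp add: hform_def sum_subtractf algebra_simps)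

lemma hform_smult: "hform d (smult c p) x y = c * hform d p x y"
  by (simp add: hform_def sum_distrib_left algebra_simps)

lemma hform_dehomogenize:
  assumes "degree p \<le> d" "y \<noteq> 0"
  shows "hform d p x y = y ^ d * poly p (x / y)"
  using hform_scale[of d p y "x / y" 1] hform_one[OF assms(1)] assms(2) by simp

lemma rmap_proj:
  assumes "degree p \<le> d" "degree q \<le> d" "(x, y) \<noteq> (0, 0)"
  shows "rmap d p q (proj x y) = proj (hform d p x y) (hform d q x y)"
proof (cases "y = 0")
  case True
  then show ?thesis
    using assms(3) proj_scale[of "x ^ d" "coeff p d" "coeff q d"]
    by (simp add: hform_zero rmap_def proj_def mult_ac)
next
  case False
  then have "rmap d p q (proj x y) = proj (poly p (x / y)) (poly q (x / y))"
    by (simp add: proj_def rmap_def)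
  also have "\<dots> = proj (y ^ d * poly p (x / y)) (y ^ d * poly q (x / y))"
    using False by (simp add: proj_scale)
  finally show ?thesis
    using False assms hform_dehomogenize[of p d y x] hform_dehomogenize[of q d y x] by simp
qed

text \<open>A finite common zero would be a common linear factor; one at infinity contradicts the
  degree or, if both polynomials vanish, coprimality.\<close>

lemma nondegenerate_rat_pairs:
  assumes "(p, q) \<in> rat_pairs d"
  shows "nondegenerate d p q"
proof -
  have cop: "coprime p q" and deg: "max (degree p) (degree q) = d"
    using assms by (auto simp: rat_pairs_def)
  have "hform d p x y \<noteq> 0 \<or> hform d q x y \<noteq> 0" if "(x, y) \<noteq> (0, 0)" for x y
  proof (rule ccontr)
    assume "\<not> ?thesis"
    then have 0: "hform d p x y = 0" "hform d q x y = 0" by auto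
    show False
    proof (cases "y = 0")
      case True
      then have "coeff p d = 0" "coeff q d = 0" using 0 that by (auto simp: hform_zero)
      then have "p = 0 \<or> degree p \<noteq> d" "q = 0 \<or> degree q \<noteq> d"
        using leading_coeff_0_iff by blast+
      then have "p = 0 \<and> q = 0" using deg by (metis degree_0 max_0L max_def max.commute le_zero_eq)
      then show False using cop by simp
    next
      case False
      then have "poly p (x / y) = 0" "poly q (x / y) = 0"
        using 0 deg hform_dehomogenize[of p d y x] hform_dehomogenize[of q d y x] by auto
      then have "[:- (x / y), 1:] dvd p" "[:- (x / y), 1:] dvd q" by (simp_all add: poly_eq_0_iff_dvd)
      then have "is_unit [:- (x / y), 1:]" using cop by (meson coprime_common_divisor)
      then show False by (simp add: is_unit_iff_degree)
    qed
  qed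
  then show ?thesis using deg by (auto simp: nondegenerate_def)
qed

lemma rat_map_eq_rmap:
  assumes "(p, q) \<in> rat_pairs d"
  shows "rat_map p q = rmap d p q"
proof -
  have "max (degree p) (degree q) = d" using assms by (auto simp: rat_pairs_def)
  then show ?thesis
    by (auto simp: fun_eq_iff rat_map_def rmap_def proj_def split: option.split)
qed

lemma Rat_obtain:
  assumes "f \<in> Rat d"
  obtains p q where "nondegenerate d p q" "f = rmap d p q"
proof -
  obtain p q where "(p, q) \<in> rat_pairs d" "f = rat_map p q"
    using assms by (auto simp: Rat_def)
  then show thesis
    using that nondegenerate_rat_pairs rat_map_eq_rmap by metis
qed

subsection \<open>Iterates\<close>

text \<open>The analogue of \<open>hform\<close> with polynomial arguments. Composing forms and
  never cancelling factors makes the coefficients of the iterates polynomial in those of the map,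
  which is what \<open>poly_seq_iterate\<close> exploits.\<close>

definition hpoly :: "nat \<Rightarrow> complex poly \<Rightarrow> complex poly \<Rightarrow> complex poly \<Rightarrow> complex poly" where
  "hpoly d p A B = (\<Sum>i\<le>d. smult (coeff p i) (A ^ i * B ^ (d - i)))"

primrec iterate_pair ::
  "nat \<Rightarrow> complex poly \<Rightarrow> complex poly \<Rightarrow> nat \<Rightarrow> complex poly \<times> complex poly" where
  "iterate_pair d p q 0 = ([:0, 1:], 1)"
| "iterate_pair d p q (Suc l) =
    (hpoly d p (fst (iterate_pair d p q l)) (snd (iterate_pair d p q l)),
     hpoly d q (fst (iterate_pair d p q l)) (snd (iterate_pair d p q l)))"

definition num :: "nat \<Rightarrow> complex poly \<Rightarrow> complex poly \<Rightarrow> nat \<Rightarrow> complex poly" where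
  "num d p q l = fst (iterate_pair d p q l)"

definition den :: "nat \<Rightarrow> complex poly \<Rightarrow> complex poly \<Rightarrow> nat \<Rightarrow> complex poly" where
  "den d p q l = snd (iterate_pair d p q l)"

lemma num_den_simps [simp]:
  "num d p q 0 = [:0, 1:]" "den d p q 0 = 1"
  "num d p q (Suc l) = hpoly d p (num d p q l) (den d p q l)"
  "den d p q (Suc l) = hpoly d q (num d p q l) (den d p q l)"
  by (simp_all add: num_def den_def)

lemma poly_hpoly: "poly (hpoly d p A B) w = hform d p (poly A w) (poly B w)"
  by (simp add: hpoly_def hform_def poly_sum mult_ac)

text \<open>The first half says that numerator and denominator have no common root. It is carried
  through the induction because \<open>rmap_proj\<close> says nothing about the junk value
  \<open>proj 0 0\<close>.\<close>

lemma iterate_rmap: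
  assumes "nondegenerate d p q"
  shows "(poly (num d p q l) w, poly (den d p q l) w) \<noteq> (0, 0) \<and>
    (rmap d p q ^^ l) (Some w) = proj (poly (num d p q l) w) (poly (den d p q l) w)"
proof (induction l)
  case 0
  then show ?case by (simp add: proj_def)
next
  case (Suc l)
  let ?A = "poly (num d p q l) w" and ?B = "poly (den d p q l) w"
  have nz: "(?A, ?B) \<noteq> (0, 0)" using Suc by blast
  have "(rmap d p q ^^ Suc l) (Some w) = rmap d p q (proj ?A ?B)" using Suc by simp
  also have "\<dots> = proj (hform d p ?A ?B) (hform d q ?A ?B)"
    using assms nz by (intro rmap_proj) (auto simp: nondegenerate_def)
  finally show ?case
    using assms nz by (auto simp: poly_hpoly nondegenerate_def)
qed

lemma iterate_fixed:
  assumes "nondegenerate d p q" "(rmap d p q ^^ l) (Some w) = Some w"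
  shows "poly (den d p q l) w \<noteq> 0" "poly (num d p q l) w = w * poly (den d p q l) w"
proof -
  have "Some w = proj (poly (num d p q l) w) (poly (den d p q l) w)"
    using iterate_rmap[OF assms(1), of l w] assms(2) by simp
  then show "poly (den d p q l) w \<noteq> 0" "poly (num d p q l) w = w * poly (den d p q l) w"
    by (simp_all add: proj_def field_simps split: if_splits)
qed

text \<open>This includes poles: there \<open>affine_part\<close> has the default value 0, and so
  has division by 0.\<close>

lemma affine_part_proj: "g (Some w) = proj x y \<Longrightarrow> affine_part g w = x / y"
  by (simp add: affine_part_def proj_def)

lemma affine_part_iterate:
  assumes "nondegenerate d p q"
  shows "affine_part (rmap d p q ^^ l) w = poly (num d p q l) w / poly (den d p q l) w"
  using iterate_rmap[OF assms, of l w] by (auto intro: affine_part_proj)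

definition quot_deriv :: "complex poly \<Rightarrow> complex poly \<Rightarrow> complex \<Rightarrow> complex" where
  "quot_deriv A B w =
    (poly (pderiv A) w * poly B w - poly A w * poly (pderiv B) w) / (poly B w * poly B w)"

lemma quot_has_deriv:
  assumes "poly B w \<noteq> 0"
  shows "((\<lambda>u. poly A u / poly B u) has_field_derivative quot_deriv A B w) (at w)"
  unfolding quot_deriv_def by (rule DERIV_divide[OF poly_DERIV poly_DERIV assms])

lemma fixed_point_deriv_iterate:
  assumes "nondegenerate d p q" "(rmap d p q ^^ l) (Some w) = Some w"
  shows "fixed_point_deriv (rmap d p q ^^ l) (Some w) = quot_deriv (num d p q l) (den d p q l) w"
proof -
  have "affine_part (rmap d p q ^^ l) = (\<lambda>u. poly (num d p q l) u / poly (den d p q l) u)"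
    using affine_part_iterate[OF assms(1)] by blast
  then show ?thesis
    using DERIV_imp_deriv[OF quot_has_deriv[OF iterate_fixed(1)[OF assms]]]
    by (simp add: fixed_point_deriv_def)
qed

subsection \<open>Conjugation\<close>

text \<open>Chain rule: the derivatives of the two coordinate changes cancel at a fixed point. The
  conjugacy is required only near the point, since formulas in the affine chart can fail at poles
  elsewhere.\<close>

lemma deriv_conjugate:
  fixes \<gamma> \<mu> \<nu> h :: "complex \<Rightarrow> complex"
  assumes "(\<gamma> has_field_derivative L) (at w)" "\<gamma> w = w"
    and "(\<nu> has_field_derivative b) (at w')" "\<nu> w' = w"
    and "(\<mu> has_field_derivative a) (at w)" "a * b = 1"
    and "\<forall>\<^sub>F u in nhds w'. h u = \<mu> (\<gamma> (\<nu> u))"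
  shows "deriv h w' = L"
proof -
  have 1: "((\<lambda>u. \<gamma> (\<nu> u)) has_field_derivative L * b) (at w')"
    using DERIV_chain2[OF _ assms(3), of \<gamma> L] assms(1,4) by simp
  have "((\<lambda>u. \<mu> (\<gamma> (\<nu> u))) has_field_derivative a * (L * b)) (at w')"
    using DERIV_chain2[OF _ 1, of \<mu> a] assms(2,4,5) by simp
  then have "(h has_field_derivative a * (L * b)) (at w')"
    using DERIV_cong_ev[OF refl assms(7) refl] by blast
  moreover have "a * (L * b) = L" using assms(6) by (simp add: mult_ac)
  ultimately show ?thesis using DERIV_imp_deriv by metis
qed

lemma eventually_poly_nonzero:
  fixes B :: "complex poly"
  assumes "poly B w \<noteq> 0"
  shows "\<forall>\<^sub>F u in nhds w. poly B u \<noteq> 0"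
proof -
  have "open {u. poly B u \<noteq> 0}"
    by (intro open_Collect_neq continuous_intros)
  then show ?thesis using assms by (auto simp: eventually_nhds)
qed

lemma eventually_poly_nonzero_comp:
  fixes B :: "complex poly" and \<nu> :: "complex \<Rightarrow> complex"
  assumes "poly B (\<nu> w) \<noteq> 0" "(\<nu> has_field_derivative b) (at w)"
  shows "\<forall>\<^sub>F u in nhds w. poly B (\<nu> u) \<noteq> 0"
proof -
  have "filterlim \<nu> (nhds (\<nu> w)) (nhds w)"
    using DERIV_isCont[OF assms(2)] by (simp add: isCont_def flip: tendsto_at_iff_tendsto_nhds)
  with eventually_poly_nonzero[OF assms(1)] show ?thesis
    by (rule eventually_compose_filterlim)
qed

lemma funpow_conjugate:
  assumes "i \<circ> m = id" "m \<circ> i = id"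
  shows "(m \<circ> f \<circ> i) ^^ l = m \<circ> (f ^^ l) \<circ> i"
proof (induction l)
  case 0
  then show ?case using assms by simp
next
  case (Suc l)
  have "i (m x) = x" for x using assms(1) by (metis comp_apply id_apply)
  then show ?case using Suc by (auto simp: fun_eq_iff)
qed

text \<open>All that multipliers retain of a conjugacy. The single point map \<phi> serves every
  iterate, and steps compose without the Moebius map being written down.\<close>

definition same_multipliers ::
  "nat \<Rightarrow> complex poly \<Rightarrow> complex poly \<Rightarrow> complex poly \<Rightarrow> complex poly \<Rightarrow> bool" where
  "same_multipliers d p q p' q' \<longleftrightarrow> (\<exists>\<phi>. \<forall>l x. (rmap d p q ^^ l) x = x \<longrightarrow>
     (rmap d p' q' ^^ l) (\<phi> x) = \<phi> x \<and>
     fixed_point_deriv (rmap d p' q' ^^ l) (\<phi> x) = fixed_point_deriv (rmap d p q ^^ l) x)"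

lemma same_multipliers_refl: "same_multipliers d p q p q"
  unfolding same_multipliers_def by (rule exI[of _ id]) simp

lemma same_multipliers_trans:
  assumes "same_multipliers d p q p' q'" "same_multipliers d p' q' p'' q''"
  shows "same_multipliers d p q p'' q''"
proof -
  obtain \<phi> where \<phi>: "\<And>l x. (rmap d p q ^^ l) x = x \<Longrightarrow>
     (rmap d p' q' ^^ l) (\<phi> x) = \<phi> x \<and>
     fixed_point_deriv (rmap d p' q' ^^ l) (\<phi> x) = fixed_point_deriv (rmap d p q ^^ l) x"
    using assms(1) unfolding same_multipliers_def by blast
  obtain \<psi> where \<psi>: "\<And>l x. (rmap d p' q' ^^ l) x = x \<Longrightarrow>
     (rmap d p'' q'' ^^ l) (\<psi> x) = \<psi> x \<and>
     fixed_point_deriv (rmap d p'' q'' ^^ l) (\<psi> x) = fixed_point_deriv (rmap d p' q' ^^ l) x"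
    using assms(2) unfolding same_multipliers_def by blast
  show ?thesis
    unfolding same_multipliers_def
    by (rule exI[of _ "\<lambda>x. \<psi> (\<phi> x)"]) (simp add: \<phi> \<psi>)
qed

lemma sphere_inversion_proj: "(x, y) \<noteq> (0, 0) \<Longrightarrow> sphere_inversion (proj x y) = proj y x"
  by (auto simp: sphere_inversion_def proj_def)

lemma sphere_inversion_involution: "sphere_inversion (sphere_inversion z) = z"
  by (auto simp: sphere_inversion_def split: option.split)

text \<open>Reversal at the fixed degree \<open>d\<close>, not at the degree of \<open>p\<close>:
  this is the exchange of the two variables in \<open>hform d p\<close>.\<close>

definition reverse_poly :: "nat \<Rightarrow> complex poly \<Rightarrow> complex poly" where
  "reverse_poly d p = (\<Sum>i\<le>d. monom (coeff p i) (d - i))"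

lemma coeff_reverse_poly: "coeff (reverse_poly d p) j = (if j \<le> d then coeff p (d - j) else 0)"
proof -
  have "coeff (reverse_poly d p) j = (\<Sum>i\<le>d. if d - i = j then coeff p i else 0)"
    by (simp add: reverse_poly_def coeff_sum)
  also have "\<dots> = (\<Sum>i\<in>(if j \<le> d then {d - j} else {}). if d - i = j then coeff p i else 0)"
    by (intro sum.mono_neutral_right) (auto split: if_splits)
  finally show ?thesis by simp
qed

lemma degree_reverse_poly: "degree (reverse_poly d p) \<le> d"
  by (rule degree_le) (simp add: coeff_reverse_poly)

lemma hform_reverse_poly: "hform d (reverse_poly d p) x y = hform d p y x"
  unfolding hform_def
  by (rule sum.reindex_bij_witness[where i = "\<lambda>i. d - i" and j = "\<lambda>i. d - i"])
    (auto simp: coeff_reverse_poly)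

lemma nondegenerate_reverse:
  "nondegenerate d p q \<Longrightarrow> nondegenerate d (reverse_poly d q) (reverse_poly d p)"
  by (auto simp: nondegenerate_def hform_reverse_poly degree_reverse_poly)

lemma rmap_reverse:
  assumes "nondegenerate d p q"
  shows "rmap d (reverse_poly d q) (reverse_poly d p) = sphere_inversion \<circ> rmap d p q \<circ> sphere_inversion"
proof
  fix z
  obtain x y where z: "z = proj x y" "(x, y) \<noteq> (0, 0)" by (rule proj_cases)
  then have yx: "(y, x) \<noteq> (0, 0)" by auto
  have "rmap d (reverse_poly d q) (reverse_poly d p) z = proj (hform d q y x) (hform d p y x)"
    using z by (simp add: rmap_proj degree_reverse_poly hform_reverse_poly)
  moreover have "rmap d p q (sphere_inversion z) = proj (hform d p y x) (hform d q y x)"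
    unfolding z sphere_inversion_proj[OF z(2)]
    using assms yx by (intro rmap_proj) (auto simp: nondegenerate_def)
  moreover have "(hform d p y x, hform d q y x) \<noteq> (0, 0)"
    using assms yx by (auto simp: nondegenerate_def)
  ultimately show "rmap d (reverse_poly d q) (reverse_poly d p) z
      = (sphere_inversion \<circ> rmap d p q \<circ> sphere_inversion) z"
    by (simp add: sphere_inversion_proj)
qed

lemma rmap_reverse_iterate:
  assumes "nondegenerate d p q"
  shows "rmap d (reverse_poly d q) (reverse_poly d p) ^^ l =
    sphere_inversion \<circ> (rmap d p q ^^ l) \<circ> sphere_inversion"
  unfolding rmap_reverse[OF assms]
  by (rule funpow_conjugate) (auto simp: fun_eq_iff sphere_inversion_involution)

lemma same_multipliers_reverse:
  assumes "nondegenerate d p q"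
  shows "same_multipliers d p q (reverse_poly d q) (reverse_poly d p)"
  unfolding same_multipliers_def
proof (intro exI[of _ sphere_inversion] allI impI conjI)
  fix l x assume fixp: "(rmap d p q ^^ l) x = x"
  let ?g = "rmap d p q ^^ l"
  let ?h = "rmap d (reverse_poly d q) (reverse_poly d p) ^^ l"
  have h: "?h z = sphere_inversion (?g (sphere_inversion z))" for z
    by (simp add: rmap_reverse_iterate[OF assms])
  show "?h (sphere_inversion x) = sphere_inversion x"
    by (simp add: h sphere_inversion_involution fixp)
  show "fixed_point_deriv ?h (sphere_inversion x) = fixed_point_deriv ?g x"
  \<comment> \<open>At infinity, and at 0 which is sent there, the definition of
    \<open>fixed_point_deriv\<close> already uses the coordinate \<open>1 / z\<close>. Only the
    other points need the chain rule.\<close>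
  proof (cases x)
    case None
    then show ?thesis
      by (simp add: fixed_point_deriv_def sphere_inversion_def[of None] rmap_reverse_iterate[OF assms])
  next
    case (Some w)
    show ?thesis
    proof (cases "w = 0")
      case True
      have "sphere_inversion \<circ> ?h \<circ> sphere_inversion = ?g"
        by (simp add: fun_eq_iff h sphere_inversion_involution)
      then show ?thesis
        using True Some by (simp add: fixed_point_deriv_def sphere_inversion_def[of "Some 0"])
    next
      case False
      define A B where "A = num d p q l" and "B = den d p q l"
      define \<gamma> where "\<gamma> = (\<lambda>u. poly A u / poly B u)"
      have fixw: "?g (Some w) = Some w" using fixp Some by simp
      have B: "poly B w \<noteq> 0" and A: "poly A w = w * poly B w"
        using iterate_fixed[OF assms fixw] by (auto simp: A_def B_def)
      have "deriv (affine_part ?h) (inverse w) = quot_deriv A B w"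
      proof (rule deriv_conjugate)
        show "(\<gamma> has_field_derivative quot_deriv A B w) (at w)"
          unfolding \<gamma>_def using B by (rule quot_has_deriv)
        show "\<gamma> w = w" using A B by (simp add: \<gamma>_def)
        show "(inverse has_field_derivative - (inverse (inverse w) ^ Suc (Suc 0))) (at (inverse w))"
          using False by (intro DERIV_inverse) simp
        show "(inverse has_field_derivative - (inverse w ^ Suc (Suc 0))) (at w)"
          using False by (intro DERIV_inverse)
        show "inverse (inverse w) = w" by simp
        show "- (inverse w ^ Suc (Suc 0)) * - (inverse (inverse w) ^ Suc (Suc 0)) = 1"
          using False by (simp add: field_simps)
        have "\<forall>\<^sub>F u in nhds (inverse w). u \<noteq> 0"
          using False by (intro t1_space_nhds) simp
        then show "\<forall>\<^sub>F u in nhds (inverse w). affine_part ?h u = inverse (\<gamma> (inverse u))"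
        proof eventually_elim
          case (elim u)
          have "?h (Some u) = sphere_inversion (?g (Some (inverse u)))"
            using elim by (simp add: h sphere_inversion_def[of "Some u"] inverse_eq_divide)
          also have "\<dots> = proj (poly B (inverse u)) (poly A (inverse u))"
            using iterate_rmap[OF assms, of l "inverse u"]
            by (simp add: A_def B_def sphere_inversion_proj)
          finally have "affine_part ?h u = poly B (inverse u) / poly A (inverse u)"
            by (rule affine_part_proj)
          then show ?case by (simp add: \<gamma>_def)
        qed
      qed
      then show ?thesis
        using Some False fixed_point_deriv_iterate[OF assms fixw]
        by (simp add: fixed_point_deriv_def sphere_inversion_def[of "Some w"] A_def B_def inverse_eq_divide)
    qed
  qed
qed

definition affine_map :: "complex \<Rightarrow> complex \<Rightarrow> riemann_sphere \<Rightarrow> riemann_sphere" where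
  "affine_map a b = map_option (\<lambda>z. a * z + b)"

lemma affine_map_proj: "affine_map a b (proj x y) = proj (a * x + b * y) y"
  by (simp add: affine_map_def proj_def add_divide_distrib)

lemma degree_pcompose_linear: "degree (pcompose p [:r, a:]) \<le> degree p" for r a :: complex
proof -
  have "degree (pcompose p [:r, a:]) \<le> degree p * degree [:r, a:]" by (rule degree_pcompose_le)
  also have "\<dots> \<le> degree p * 1" by (intro mult_left_mono) auto
  finally show ?thesis by simp
qed

lemma coeff_pcompose_linear:
  fixes a :: complex
  assumes "degree p \<le> d" "a \<noteq> 0"
  shows "coeff (pcompose p [:r, a:]) d = coeff p d * a ^ d"
proof (cases "degree p = d")
  case True
  then show ?thesis
    using lead_coeff_comp[of "[:r, a:]" p] assms by (simp add: degree_pcompose)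
next
  case False
  then have "degree (pcompose p [:r, a:]) < d" "degree p < d"
    using degree_pcompose_linear[of p r a] assms by linarith+
  then show ?thesis by (simp add: coeff_eq_0)
qed

lemma hform_pcompose:
  assumes "degree p \<le> d" "a \<noteq> 0"
  shows "hform d (pcompose p [:r, a:]) x y = hform d p (a * x + r * y) y"
proof (cases "y = 0")
  case True
  then show ?thesis
    using coeff_pcompose_linear[OF assms, of r] by (simp add: hform_zero power_mult_distrib)
next
  case False
  have "degree (pcompose p [:r, a:]) \<le> d"
    using degree_pcompose_linear[of p r a] assms by linarith
  moreover have "(a * x + r * y) / y = r + a * (x / y)" using False by (simp add: field_simps)
  ultimately show ?thesis
    using assms False by (simp add: hform_dehomogenize poly_pcompose mult.commute)
qed

text \<open>
  The conjugate of \<open>p / q\<close> by \<open>z \<mapsto> a z + r\<close> is \<open>(p(a z + r) - r q(a z + r)) / (a q(a z + r))\<close>.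
\<close>

definition affine_num :: "complex \<Rightarrow> complex \<Rightarrow> complex poly \<Rightarrow> complex poly \<Rightarrow> complex poly" where
  "affine_num a r p q = smult (1 / a) (pcompose p [:r, a:] - smult r (pcompose q [:r, a:]))"

lemma hform_affine_num:
  assumes "degree p \<le> d" "degree q \<le> d" "a \<noteq> 0"
  shows "hform d (affine_num a r p q) x y =
    (hform d p (a * x + r * y) y - r * hform d q (a * x + r * y) y) / a"
  using assms by (simp add: affine_num_def hform_smult hform_diff hform_pcompose)

lemma degree_affine_num:
  assumes "degree p \<le> d" "degree q \<le> d"
  shows "degree (affine_num a r p q) \<le> d"
  unfolding affine_num_def
  using degree_pcompose_linear[of p r a] degree_pcompose_linear[of q r a] assms
  by (intro order.trans[OF degree_smult_le] degree_diff_le) (auto intro: order.trans)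

lemma nondegenerate_affine:
  assumes "nondegenerate d p q" "a \<noteq> 0"
  shows "nondegenerate d (affine_num a r p q) (pcompose q [:r, a:])"
proof -
  have deg: "degree p \<le> d" "degree q \<le> d" using assms(1) by (auto simp: nondegenerate_def)
  have "hform d (affine_num a r p q) x y \<noteq> 0 \<or> hform d (pcompose q [:r, a:]) x y \<noteq> 0"
    if "(x, y) \<noteq> (0, 0)" for x y
  proof -
    have "(a * x + r * y, y) \<noteq> (0, 0)" using that assms(2) by auto
    then have "hform d p (a * x + r * y) y \<noteq> 0 \<or> hform d q (a * x + r * y) y \<noteq> 0"
      using assms(1) unfolding nondegenerate_def by blast
    then show ?thesis
      using assms(2) by (auto simp: hform_affine_num[OF deg assms(2)] hform_pcompose[OF deg(2) assms(2)])
  qed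
  then show ?thesis
    using degree_affine_num[OF deg] degree_pcompose_linear[of q r a] deg(2)
    unfolding nondegenerate_def by (meson order.trans)
qed

lemma rmap_affine:
  assumes "nondegenerate d p q" "a \<noteq> 0"
  shows "rmap d (affine_num a r p q) (pcompose q [:r, a:]) =
    affine_map (1 / a) (- r / a) \<circ> rmap d p q \<circ> affine_map a r"
proof
  fix z
  have deg: "degree p \<le> d" "degree q \<le> d" using assms(1) by (auto simp: nondegenerate_def)
  have deg': "degree (affine_num a r p q) \<le> d" "degree (pcompose q [:r, a:]) \<le> d"
    using nondegenerate_affine[OF assms, of r] by (auto simp: nondegenerate_def)
  obtain x y where z: "z = proj x y" "(x, y) \<noteq> (0, 0)" by (rule proj_cases)
  then have yx: "(a * x + r * y, y) \<noteq> (0, 0)" using assms(2) by auto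
  let ?P = "hform d p (a * x + r * y) y" and ?Q = "hform d q (a * x + r * y) y"
  have "rmap d (affine_num a r p q) (pcompose q [:r, a:]) z = proj ((?P - r * ?Q) / a) ?Q"
    unfolding z(1) rmap_proj[OF deg' z(2)]
    by (simp add: hform_affine_num[OF deg assms(2)] hform_pcompose[OF deg(2) assms(2)])
  moreover have "(affine_map (1 / a) (- r / a) \<circ> rmap d p q \<circ> affine_map a r) z
      = proj (1 / a * ?P + - r / a * ?Q) ?Q"
    unfolding z(1) comp_apply affine_map_proj rmap_proj[OF deg yx] ..
  moreover have "1 / a * ?P + - r / a * ?Q = (?P - r * ?Q) / a"
    by (simp add: diff_divide_distrib)
  ultimately show "rmap d (affine_num a r p q) (pcompose q [:r, a:]) z =
    (affine_map (1 / a) (- r / a) \<circ> rmap d p q \<circ> affine_map a r) z" by simp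
qed

lemma affine_map_inverse:
  assumes "a \<noteq> 0"
  shows "affine_map (1 / a) (- r / a) (affine_map a r z) = z"
    "affine_map a r (affine_map (1 / a) (- r / a) z) = z"
  using assms by (cases z; simp add: affine_map_def field_simps)+

lemma rmap_affine_iterate:
  assumes "nondegenerate d p q" "a \<noteq> 0"
  shows "rmap d (affine_num a r p q) (pcompose q [:r, a:]) ^^ l =
    affine_map (1 / a) (- r / a) \<circ> (rmap d p q ^^ l) \<circ> affine_map a r"
  unfolding rmap_affine[OF assms]
  by (rule funpow_conjugate; rule ext; simp only: comp_apply id_apply affine_map_inverse[OF assms(2)])

lemma same_multipliers_affine:
  assumes nd: "nondegenerate d p q" and a: "a \<noteq> 0"
  shows "same_multipliers d p q (affine_num a r p q) (pcompose q [:r, a:])"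
  unfolding same_multipliers_def
proof (intro exI[of _ "affine_map (1 / a) (- r / a)"] allI impI conjI)
  fix l x assume fixp: "(rmap d p q ^^ l) x = x"
  let ?m = "affine_map (1 / a) (- r / a)"
  let ?g = "rmap d p q ^^ l"
  let ?h = "rmap d (affine_num a r p q) (pcompose q [:r, a:]) ^^ l"
  have h: "?h z = ?m (?g (affine_map a r z))" for z
    by (simp add: rmap_affine_iterate[OF nd a])
  show "?h (?m x) = ?m x"
    by (simp only: h affine_map_inverse(2)[OF a] fixp)
  show "fixed_point_deriv ?h (?m x) = fixed_point_deriv ?g x"
  proof (cases x)
    case (Some w)
    define A B where "A = num d p q l" and "B = den d p q l"
    define \<gamma> where "\<gamma> = (\<lambda>u. poly A u / poly B u)"
    define \<mu> where "\<mu> = (\<lambda>v. (v - r) / a)"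
    define \<nu> where "\<nu> = (\<lambda>u. a * u + r)"
    have fixw: "?g (Some w) = Some w" using fixp Some by simp
    have B: "poly B w \<noteq> 0" and A: "poly A w = w * poly B w"
      using iterate_fixed[OF nd fixw] by (auto simp: A_def B_def)
    have "deriv (affine_part ?h) (\<mu> w) = quot_deriv A B w"
    proof (rule deriv_conjugate)
      show "(\<gamma> has_field_derivative quot_deriv A B w) (at w)"
        unfolding \<gamma>_def using B by (rule quot_has_deriv)
      show "\<gamma> w = w" using A B by (simp add: \<gamma>_def)
      show d\<nu>: "(\<nu> has_field_derivative a) (at (\<mu> w))"
        unfolding \<nu>_def by (auto intro!: derivative_eq_intros)
      show "(\<mu> has_field_derivative 1 / a) (at w)"
        unfolding \<mu>_def using a by (auto intro!: derivative_eq_intros)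
      show \<nu>\<mu>: "\<nu> (\<mu> w) = w" using a by (simp add: \<nu>_def \<mu>_def)
      show "1 / a * a = 1" using a by simp
      \<comment> \<open>Poles must be kept away: the default value 0 of \<open>affine_part\<close>
        is in general not preserved by \<mu>.\<close>
      have "\<forall>\<^sub>F u in nhds (\<mu> w). poly B (\<nu> u) \<noteq> 0"
        by (rule eventually_poly_nonzero_comp[OF _ d\<nu>]) (simp add: \<nu>\<mu> B)
      then show "\<forall>\<^sub>F u in nhds (\<mu> w). affine_part ?h u = \<mu> (\<gamma> (\<nu> u))"
      proof eventually_elim
        case (elim u)
        have "?h (Some u) = ?m (proj (poly A (\<nu> u)) (poly B (\<nu> u)))"
          using iterate_rmap[OF nd, of l "\<nu> u"]
          by (simp add: h affine_map_def \<nu>_def A_def B_def)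
        then show ?case
          using elim a by (simp add: affine_map_def proj_def affine_part_def \<gamma>_def \<mu>_def field_simps)
      qed
    qed
    moreover have "?m (Some w) = Some (\<mu> w)" using a by (simp add: affine_map_def \<mu>_def field_simps)
    ultimately show ?thesis
      using Some fixed_point_deriv_iterate[OF nd fixw]
      by (simp add: fixed_point_deriv_def A_def B_def)
  next
    case None
    \<comment> \<open>At infinity, compute in the coordinate \<open>1 / z\<close>. The reversed map
      fixes 0, and \<open>z \<mapsto> a * z + r\<close> becomes
      \<open>u \<mapsto> u / (a + r * u)\<close>, which has derivative \<open>1 / a\<close> at 0;
      its inverse there is \<mu>.\<close>
    let ?p = "reverse_poly d q" and ?q = "reverse_poly d p"
    have nd': "nondegenerate d ?p ?q" by (rule nondegenerate_reverse[OF nd])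
    let ?g' = "rmap d ?p ?q ^^ l"
    have g': "?g' = sphere_inversion \<circ> ?g \<circ> sphere_inversion" by (rule rmap_reverse_iterate[OF nd])
    define A B where "A = num d ?p ?q l" and "B = den d ?p ?q l"
    define \<gamma> where "\<gamma> = (\<lambda>u. poly A u / poly B u)"
    define \<mu> where "\<mu> = (\<lambda>v. a * v / (1 - r * v))"
    define \<nu> where "\<nu> = (\<lambda>u. u / (a + r * u))"
    have fix0: "?g' (Some 0) = Some 0"
      using fixp None by (simp add: g' sphere_inversion_def)
    have B: "poly B 0 \<noteq> 0" and A: "poly A 0 = 0"
      using iterate_fixed[OF nd' fix0] by (auto simp: A_def B_def)
    let ?h' = "sphere_inversion \<circ> ?h \<circ> sphere_inversion"
    have "deriv (affine_part ?h') 0 = quot_deriv A B 0"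
    proof (rule deriv_conjugate)
      show "(\<gamma> has_field_derivative quot_deriv A B 0) (at 0)"
        unfolding \<gamma>_def using B by (rule quot_has_deriv)
      show "\<gamma> 0 = 0" using A B by (simp add: \<gamma>_def)
      show d\<nu>: "(\<nu> has_field_derivative 1 / a) (at 0)"
        unfolding \<nu>_def using a by (auto intro!: derivative_eq_intros simp: power2_eq_square)
      show "(\<mu> has_field_derivative a) (at 0)"
        unfolding \<mu>_def using a by (auto intro!: derivative_eq_intros)
      show "\<nu> 0 = 0" by (simp add: \<nu>_def)
      show "a * (1 / a) = 1" using a by simp
      have "\<forall>\<^sub>F u in nhds 0. poly B (\<nu> u) \<noteq> 0"
        by (rule eventually_poly_nonzero_comp[OF _ d\<nu>]) (simp add: \<nu>_def B)
      moreover have "\<forall>\<^sub>F u in nhds 0. poly [:a, r:] u \<noteq> 0"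
        using a by (intro eventually_poly_nonzero) simp
      ultimately show "\<forall>\<^sub>F u in nhds 0. affine_part ?h' u = \<mu> (\<gamma> (\<nu> u))"
      proof eventually_elim
        case (elim u)
        let ?X = "poly A (\<nu> u)" and ?Y = "poly B (\<nu> u)"
        have au: "a + r * u \<noteq> 0" using elim by (simp add: mult.commute)
        have "Some u = proj u 1" by (simp add: proj_def)
        then have "affine_map a r (sphere_inversion (Some u)) = proj (a + r * u) u"
          by (simp add: sphere_inversion_proj affine_map_proj)
        also have "\<dots> = sphere_inversion (proj u (a + r * u))"
          using au by (subst sphere_inversion_proj) auto
        also have "proj u (a + r * u) = Some (\<nu> u)"
          using au by (simp add: proj_def \<nu>_def)
        finally have "?g (affine_map a r (sphere_inversion (Some u))) = sphere_inversion (?g' (Some (\<nu> u)))"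
          by (simp add: g' sphere_inversion_involution)
        also have "\<dots> = proj ?Y ?X"
          using iterate_rmap[OF nd', of l "\<nu> u"] by (simp add: A_def B_def sphere_inversion_proj)
        finally have h1: "?h (sphere_inversion (Some u)) = proj (1 / a * ?Y + - r / a * ?X) ?X"
          by (simp only: h affine_map_proj)
        have nz: "(1 / a * ?Y + - r / a * ?X, ?X) \<noteq> (0, 0)"
          using elim a by auto
        have "?h' (Some u) = proj ?X (1 / a * ?Y + - r / a * ?X)"
          unfolding comp_apply h1 by (rule sphere_inversion_proj[OF nz])
        then have "affine_part ?h' u = ?X / (1 / a * ?Y + - r / a * ?X)"
          by (rule affine_part_proj)
        also have "1 / a * ?Y + - r / a * ?X = ?Y * (1 - r * \<gamma> (\<nu> u)) / a"
          using elim a by (simp add: \<gamma>_def field_simps)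
        also have "?X / (?Y * (1 - r * \<gamma> (\<nu> u)) / a) = \<mu> (\<gamma> (\<nu> u))"
          using elim by (simp add: \<mu>_def \<gamma>_def)
        finally show ?case .
      qed
    qed
    moreover have "fixed_point_deriv ?g' (Some 0) = quot_deriv A B 0"
      using fixed_point_deriv_iterate[OF nd' fix0] by (simp add: A_def B_def)
    moreover have "?m None = None" by (simp add: affine_map_def)
    ultimately show ?thesis
      using None by (simp add: fixed_point_deriv_def g')
  qed
qed

subsection \<open>Normal form\<close>

lemma exists_complex_root:
  fixes v :: complex
  assumes "v \<noteq> 0" "k > 0"
  obtains a where "a ^ k = v" "a \<noteq> 0"
proof -
  have "exp (Ln v / of_nat k) ^ k = exp (Ln v)"
    using assms by (simp flip: exp_of_nat_mult)
  then show thesis using assms that[of "exp (Ln v / of_nat k)"] by simp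
qed

lemma exists_root_poly:
  fixes p :: "complex poly"
  assumes "degree p > 0"
  obtains w where "poly p w = 0"
  using fundamental_theorem_of_algebra[of p] assms by (auto simp: constant_degree)

lemma rmap_smult: "c \<noteq> 0 \<Longrightarrow> rmap d (smult c p) (smult c q) = rmap d p q"
  by (auto simp: fun_eq_iff rmap_def proj_scale split: option.split)

lemma nondegenerate_smult:
  "c \<noteq> 0 \<Longrightarrow> nondegenerate d p q \<Longrightarrow> nondegenerate d (smult c p) (smult c q)"
  by (auto simp: nondegenerate_def hform_smult)

lemma same_multipliers_normalize:
  assumes "nondegenerate d p q" "a \<noteq> 0" "c \<noteq> 0"
  shows "same_multipliers d p q (smult c (affine_num a r p q)) (smult c (pcompose q [:r, a:]))"
    "nondegenerate d (smult c (affine_num a r p q)) (smult c (pcompose q [:r, a:]))"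
  using same_multipliers_affine[OF assms(1,2), of r] rmap_smult[OF assms(3)]
    nondegenerate_smult[OF assms(3) nondegenerate_affine[OF assms(1,2)]]
  by (auto simp: same_multipliers_def)

text \<open>Infinity is fixed when the coefficient of \<open>q\<close> in degree \<open>d\<close>
  vanishes. Otherwise \<open>z * q - p\<close> has degree \<open>d + 1\<close>, and its root is a
  finite fixed point; a translation moves it to 0 and reversal moves it to infinity.\<close>

lemma exists_fixed_infinity:
  assumes nd: "nondegenerate d p q" and d: "d \<ge> 1"
  obtains p' q' where "nondegenerate d p' q'" "same_multipliers d p q p' q'" "coeff q' d = 0"
proof (cases "coeff q d = 0")
  case True
  then show thesis using that[OF nd same_multipliers_refl] by simp
next
  case False
  have deg: "degree p \<le> d" "degree q \<le> d" using nd by (auto simp: nondegenerate_def)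
  have "coeff (pCons 0 q - p) (Suc d) = coeff q d" using deg by (simp add: coeff_eq_0)
  then have "degree (pCons 0 q - p) > 0"
    using False le_degree[of "pCons 0 q - p" "Suc d"] by simp
  then obtain w where "poly (pCons 0 q - p) w = 0" by (rule exists_root_poly)
  then have w: "poly p w = w * poly q w" by simp
  let ?p = "affine_num 1 w p q" and ?q = "pcompose q [:w, 1:]"
  have nd': "nondegenerate d ?p ?q" by (rule nondegenerate_affine[OF nd]) simp
  have "poly ?p 0 = 0" using w by (simp add: affine_num_def poly_pcompose)
  then have "coeff (reverse_poly d ?p) d = 0" by (simp add: coeff_reverse_poly poly_0_coeff_0)
  then show thesis
    using that[OF nondegenerate_reverse[OF nd'] same_multipliers_trans[OF _ same_multipliers_reverse[OF nd']]]
      same_multipliers_affine[OF nd, of 1 w] by simp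
qed

text \<open>
  The point at infinity is fixed. If it has a finite preimage, one is moved to \<open>0\<close>, and
  \<open>2 (d - 1)\<close> coefficients remain free. Otherwise \<open>q = 1\<close>, and \<open>d \<le> 2 d - 2\<close> coefficients are free.
\<close>

definition normal_form :: "nat \<Rightarrow> complex poly \<Rightarrow> complex poly \<Rightarrow> bool" where
  "normal_form d p q \<longleftrightarrow> nondegenerate d p q \<and> coeff p d = 1 \<and> coeff q d = 0 \<and>
     (q = 1 \<or> coeff q 0 = 0 \<and> coeff p 0 = 1)"

text \<open>With infinity fixed there remain the conjugations by \<open>a * z + r\<close> and the
  common factor \<open>c\<close>. If \<open>q\<close> has a root, \<open>r\<close> moves it to 0,
  and \<open>a\<close> and \<open>c\<close> make two coefficients equal to 1. If \<open>q\<close> is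
  constant, \<open>c\<close> makes it 1 and \<open>a\<close> makes \<open>p\<close> monic.\<close>

lemma exists_normal_form:
  assumes nd0: "nondegenerate d p0 q0" and d: "d \<ge> 2"
  obtains p q where "normal_form d p q" "same_multipliers d p0 q0 p q"
proof -
  have "d \<ge> 1" using d by simp
  then obtain p q where nd: "nondegenerate d p q" and sm: "same_multipliers d p0 q0 p q"
    and q0: "coeff q d = 0"
    by (rule exists_fixed_infinity[OF nd0])
  have deg: "degree p \<le> d" "degree q \<le> d" using nd by (auto simp: nondegenerate_def)
  have pd: "coeff p d \<noteq> 0"
  proof -
    have "(1 :: complex, 0 :: complex) \<noteq> (0, 0)" by simp
    then have "hform d p 1 0 \<noteq> 0 \<or> hform d q 1 0 \<noteq> 0"
      using nd unfolding nondegenerate_def by blast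
    then show ?thesis using q0 by (simp add: hform_zero)
  qed
  have nroot: "poly p w \<noteq> 0 \<or> poly q w \<noteq> 0" for w
  proof -
    have "(w, 1) \<noteq> (0 :: complex, 0 :: complex)" by simp
    then have "hform d p w 1 \<noteq> 0 \<or> hform d q w 1 \<noteq> 0"
      using nd unfolding nondegenerate_def by blast
    then show ?thesis using deg by (simp add: hform_one)
  qed
  have lead: "coeff (smult c (affine_num a r p q)) d = c * coeff p d * a ^ (d - 1)"
    if "a \<noteq> 0" for a c r
  proof -
    have "a ^ d = a * a ^ (d - 1)" using d by (simp flip: power_Suc)
    then show ?thesis
      using that q0 by (simp add: affine_num_def coeff_pcompose_linear deg)
  qed
  have lead_q: "coeff (smult c (pcompose q [:r, a:])) d = 0" if "a \<noteq> 0" for a c r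
    using that q0 by (simp add: coeff_pcompose_linear deg)
  show thesis
  proof (cases "degree q = 0")
    case True
    then obtain c where c: "q = [:c:]" by (metis degree_eq_zeroE)
    have "degree p > 0" using pd d le_degree[of p d] by simp
    then obtain w where "poly p w = 0" by (rule exists_root_poly)
    then have c0: "c \<noteq> 0" using nroot[of w] c by auto
    \<comment> \<open>Conjugation multiplies the leading coefficient by \<open>a ^ (d - 1)\<close>;
      together with the factor \<open>1 / c\<close> that turns \<open>q\<close> into 1, it becomes
      1.\<close>
    obtain a where a: "a ^ (d - 1) = c / coeff p d" "a \<noteq> 0"
      using exists_complex_root[of "c / coeff p d" "d - 1"] c0 pd d by auto
    have "normal_form d (smult (1 / c) (affine_num a 0 p q)) (smult (1 / c) (pcompose q [:0, a:]))"
      using same_multipliers_normalize(2)[OF nd a(2), of "1 / c" 0] c0 pd lead[OF a(2), of "1 / c" 0]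
        lead_q[OF a(2), of "1 / c" 0] a
      unfolding normal_form_def by (simp add: c one_pCons)
    then show thesis
      using that same_multipliers_trans[OF sm same_multipliers_normalize(1)[OF nd a(2), of "1 / c" 0]] c0
      by simp
  next
    case False
    then obtain r where r: "poly q r = 0" using exists_root_poly[of q] by auto
    then have pr: "poly p r \<noteq> 0" using nroot[of r] by simp
    \<comment> \<open>After multiplication by \<open>?c\<close>, the constant coefficient is
      \<open>?c * poly p r / a\<close> and the leading one
      \<open>?c * coeff p d * a ^ (d - 1)\<close>. The first being 1 determines \<open>?c\<close>,
      and then the second asks for this value of \<open>a ^ d\<close>.\<close>
    obtain a where a: "a ^ d = poly p r / coeff p d" "a \<noteq> 0"
      using exists_complex_root[of "poly p r / coeff p d" d] pr pd d by auto
    let ?c = "a / poly p r"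
    have c0: "?c \<noteq> 0" using a pr by simp
    have ad: "a ^ d = a * a ^ (d - 1)" using d by (simp flip: power_Suc)
    have "?c * coeff p d * a ^ (d - 1) = a ^ d * coeff p d / poly p r"
      by (subst ad) (simp only: times_divide_eq_left times_divide_eq_right mult_ac)
    also have "\<dots> = 1" using a pd pr by simp
    finally have 1: "coeff (smult ?c (affine_num a r p q)) d = 1" unfolding lead[OF a(2)] .
    have 2: "poly (smult ?c (affine_num a r p q)) 0 = 1"
      using a pr r by (simp add: affine_num_def poly_pcompose)
    have 3: "poly (smult ?c (pcompose q [:r, a:])) 0 = 0"
      using r by (simp add: poly_pcompose)
    have "normal_form d (smult ?c (affine_num a r p q)) (smult ?c (pcompose q [:r, a:]))"
      using same_multipliers_normalize(2)[OF nd a(2) c0] 1 2 3 lead_q[OF a(2)]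
      unfolding normal_form_def poly_0_coeff_0 by blast
    then show thesis
      using that same_multipliers_trans[OF sm same_multipliers_normalize(1)[OF nd a(2) c0]] by blast
  qed
qed

text \<open>Since the numerator has larger degree than the denominator, only its \<open>d\<close>-th
  power reaches the top degree in \<open>hpoly\<close>. The coefficient of that power is 1 for
  \<open>p\<close> and 0 for \<open>q\<close>.\<close>

lemma iterate_degrees:
  assumes d: "d \<ge> 1" and p: "coeff p d = 1" and q: "coeff q d = 0"
  shows "degree (num d p q l) = d ^ l \<and> coeff (num d p q l) (d ^ l) = 1 \<and> degree (den d p q l) < d ^ l"
proof (induction l)
  case 0
  then show ?case by simp
next
  case (Suc l)
  define A B D where "A = num d p q l" and "B = den d p q l" and "D = d ^ l"
  have A: "degree A = D" "coeff A D = 1" and B: "degree B < D"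
    using Suc by (auto simp: A_def B_def D_def)
  have low: "degree (smult c (A ^ i * B ^ (d - i))) < d * D" if "i < d" for c i
  proof -
    have "degree (smult c (A ^ i * B ^ (d - i))) \<le> degree (A ^ i) + degree (B ^ (d - i))"
      using degree_smult_le[of c] degree_mult_le[of "A ^ i" "B ^ (d - i)"] order.trans by blast
    also have "\<dots> \<le> D * i + degree B * (d - i)"
      using degree_power_le[of A i] degree_power_le[of B "d - i"] A by simp
    also have "\<dots> < D * i + D * (d - i)"
      using B that by simp
    also have "\<dots> = D * d" using that by (simp flip: add_mult_distrib2)
    finally show ?thesis by (simp add: mult.commute)
  qed
  have dD: "d * D > 0" using B d by simp
  have sumlow: "degree (\<Sum>i<d. smult (coeff r i) (A ^ i * B ^ (d - i))) < d * D" for r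
    using low dD by (intro degree_sum_less) auto
  have split: "hpoly d r A B = smult (coeff r d) (A ^ d) + (\<Sum>i<d. smult (coeff r i) (A ^ i * B ^ (d - i)))" for r
    unfolding hpoly_def by (simp add: lessThan_Suc_atMost[symmetric] add.commute)
  have A0: "A \<noteq> 0" using A by auto
  have degA: "degree (A ^ d) = d * D" using A A0 by (simp add: degree_power_eq)
  have lcA: "coeff (A ^ d) (d * D) = 1" using lead_coeff_power[of A d] degA A by simp
  have "degree (hpoly d p A B) = d * D"
    unfolding split p using sumlow[of p] degA by (simp add: degree_add_eq_left)
  moreover have "coeff (hpoly d p A B) (d * D) = 1"
    unfolding split p using sumlow[of p] lcA by (simp add: coeff_eq_0)
  moreover have "degree (hpoly d q A B) < d * D"
    unfolding split q using sumlow[of q] by simp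
  ultimately show ?case by (simp add: A_def B_def D_def)
qed

text \<open>If every point were fixed, the denominator would have degree at least
  \<open>d ^ l - 1\<close>, hence a root, and this root would be shared by the numerator. With the
  equation nonzero, finite periodic points are algebraic over the coefficients.\<close>

lemma fixed_point_equation_nonzero:
  assumes "normal_form d p q" "d \<ge> 2" "l \<ge> 1"
  shows "num d p q l - pCons 0 (den d p q l) \<noteq> 0"
proof
  assume "num d p q l - pCons 0 (den d p q l) = 0"
  then have eq: "num d p q l = pCons 0 (den d p q l)" by simp
  have nd: "nondegenerate d p q" using assms by (simp add: normal_form_def)
  have "degree (num d p q l) = d ^ l" using assms iterate_degrees[of d p q l] by (simp add: normal_form_def)
  moreover have "d ^ l \<ge> d" using assms by (intro self_le_power) auto
  moreover have "degree (num d p q l) \<le> Suc (degree (den d p q l))"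
    unfolding eq by (rule degree_pCons_le)
  ultimately have "degree (den d p q l) > 0" using assms(2) by linarith
  then obtain w where w: "poly (den d p q l) w = 0" by (rule exists_root_poly)
  then have "poly (num d p q l) w = 0" by (simp add: eq)
  then show False using w conjunct1[OF iterate_rmap[OF nd, of l w]] by simp
qed

section \<open>Ultrafilters and separation of scales\<close>

lemma ultrafilter_cases:
  assumes "ultrafilter \<omega>"
  shows "eventually P \<omega> \<or> (\<forall>\<^sub>F n in \<omega>. \<not> P n)"
  using assms by (auto simp: ultrafilter_def)

text \<open>Any two real sequences are comparable along an ultrafilter, so almost sure inequality is
  a total preorder. The maximal index does not depend on \<open>n\<close>.\<close>

lemma ultrafilter_finite_max:
  fixes g :: "'i \<Rightarrow> 'a \<Rightarrow> real"
  assumes uf: "ultrafilter \<omega>" and "finite J" "J \<noteq> {}"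
  obtains j where "j \<in> J" "\<And>i. i \<in> J \<Longrightarrow> \<forall>\<^sub>F n in \<omega>. g i n \<le> g j n"
proof -
  have "\<exists>j\<in>J. \<forall>i\<in>J. \<forall>\<^sub>F n in \<omega>. g i n \<le> g j n"
    using assms(2,3)
  proof (induction J rule: finite_ne_induct)
    case (singleton i)
    then show ?case by simp
  next
    case (insert k J)
    then obtain j where j: "j \<in> J" "\<And>i. i \<in> J \<Longrightarrow> \<forall>\<^sub>F n in \<omega>. g i n \<le> g j n" by blast
    show ?case
    proof (cases "\<forall>\<^sub>F n in \<omega>. g k n \<le> g j n")
      case True
      then show ?thesis using j by blast
    next
      case False
      then have "\<forall>\<^sub>F n in \<omega>. \<not> g k n \<le> g j n"
        using ultrafilter_cases[OF uf, of "\<lambda>n. g k n \<le> g j n"] by blast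
      then have "\<forall>\<^sub>F n in \<omega>. g i n \<le> g k n" if "i \<in> J" for i
        using j(2)[OF that] by eventually_elim simp
      then show ?thesis by auto
    qed
  qed
  then show thesis using that by blast
qed

text \<open>If no point of \<open>K\<close> were a limit, each would have a neighbourhood that
  \<open>g\<close> avoids almost surely, and finitely many of these cover \<open>K\<close>.\<close>

lemma ultrafilter_compact_limit:
  fixes g :: "'a \<Rightarrow> 'b :: topological_space"
  assumes uf: "ultrafilter \<omega>" and K: "compact K" and ev: "\<forall>\<^sub>F n in \<omega>. g n \<in> K"
  obtains c where "c \<in> K" "(g \<longlongrightarrow> c) \<omega>"
proof (rule ccontr)
  assume "\<not> thesis"
  then have "\<forall>c\<in>K. \<exists>U. open U \<and> c \<in> U \<and> (\<forall>\<^sub>F n in \<omega>. g n \<notin> U)"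
    using that ultrafilter_cases[OF uf] unfolding tendsto_def by meson
  then obtain U where U: "\<And>c. c \<in> K \<Longrightarrow> open (U c) \<and> c \<in> U c \<and> (\<forall>\<^sub>F n in \<omega>. g n \<notin> U c)"
    by metis
  then have "K \<subseteq> (\<Union>c\<in>K. U c)" by blast
  then obtain C where C: "C \<subseteq> K" "finite C" "K \<subseteq> (\<Union>c\<in>C. U c)"
    using compactE_image[OF K, of K U] U by metis
  then have "\<forall>\<^sub>F n in \<omega>. \<forall>c\<in>C. g n \<notin> U c"
    using U by (intro eventually_ball_finite) auto
  with ev have "\<forall>\<^sub>F n in \<omega>. False"
    by eventually_elim (use C(3) in blast)
  then show False using uf by (simp add: ultrafilter_def)
qed

text \<open>Otherwise the ratio lies almost surely in the compact interval from \<open>1 / C\<close>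
  to 1. Its limit is then positive and finite, and the scales agree.\<close>

lemma scale_dominance:
  assumes uf: "ultrafilter \<omega>" and e: "e \<in> scale_seqs" and e': "e' \<in> scale_seqs"
    and ne: "scale_of \<omega> e \<noteq> scale_of \<omega> e'" and le: "\<forall>\<^sub>F n in \<omega>. e n \<le> e' n" and C: "C > 0"
  shows "\<forall>\<^sub>F n in \<omega>. C * e n \<le> e' n"
proof (rule ccontr)
  assume "\<not> ?thesis"
  then have "\<forall>\<^sub>F n in \<omega>. \<not> C * e n \<le> e' n"
    using ultrafilter_cases[OF uf, of "\<lambda>n. C * e n \<le> e' n"] by blast
  then have "\<forall>\<^sub>F n in \<omega>. e n / e' n \<in> {1 / C..1}"
    using le
  proof eventually_elim
    case (elim n)
    have "e' n > 0" using e' by (auto simp: scale_seqs_def)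
    then show ?case using elim C by (simp add: field_simps)
  qed
  then obtain c where c: "c \<in> {1 / C..1}" "((\<lambda>n. e n / e' n) \<longlongrightarrow> c) \<omega>"
    using ultrafilter_compact_limit[OF uf compact_Icc] by metis
  have "0 < 1 / C" using C by simp
  then have "c > 0" using c(1) by (simp only: atLeastAtMost_iff) linarith
  then have "(e, e') \<in> scale_rel \<omega>" using c e e' by (auto simp: scale_rel_def)
  then show False using ne unfolding scale_of_def by (metis equiv_class_eq[OF equiv_scale_rel])
qed

lemma dominant_index:
  fixes g :: "nat \<Rightarrow> 'a \<Rightarrow> real"
  assumes uf: "ultrafilter \<omega>"
    and pos: "\<And>i. i \<le> m \<Longrightarrow> \<forall>\<^sub>F n in \<omega>. g i n > 0"
    and sep: "\<And>i j. i \<le> m \<Longrightarrow> j \<le> m \<Longrightarrow> i \<noteq> j \<Longrightarrow>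
      (\<forall>C>0. \<forall>\<^sub>F n in \<omega>. C * g i n \<le> g j n) \<or> (\<forall>C>0. \<forall>\<^sub>F n in \<omega>. C * g j n \<le> g i n)"
    and J: "J \<subseteq> {..m}" "J \<noteq> {}"
  obtains k where "k \<in> J" "\<And>i C. i \<in> J \<Longrightarrow> i \<noteq> k \<Longrightarrow> C > 0 \<Longrightarrow> \<forall>\<^sub>F n in \<omega>. C * g i n \<le> g k n"
proof -
  have "finite J" using J(1) finite_subset by blast
  then obtain k where k: "k \<in> J" "\<And>i. i \<in> J \<Longrightarrow> \<forall>\<^sub>F n in \<omega>. g i n \<le> g k n"
    using ultrafilter_finite_max[OF uf _ J(2)] by metis
  have "\<forall>C>0. \<forall>\<^sub>F n in \<omega>. C * g i n \<le> g k n" if i: "i \<in> J" "i \<noteq> k" for i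
  proof (rule ccontr)
    assume "\<not> ?thesis"
    moreover have "i \<le> m" "k \<le> m" using i k J by auto
    \<comment> \<open>The maximality of \<open>k\<close> decides which alternative of
      \<open>sep\<close> holds; the factor 2 is enough to contradict it, as \<open>g k n\<close> is
      positive.\<close>
    ultimately have "\<forall>\<^sub>F n in \<omega>. 2 * g k n \<le> g i n"
      using sep[of i k] i by (meson zero_less_numeral)
    then have "\<forall>\<^sub>F n in \<omega>. False"
      using k(2)[OF i(1)] pos[OF \<open>k \<le> m\<close>] by eventually_elim simp
    then show False using uf by (simp add: ultrafilter_def)
  qed
  then show thesis using that k(1) by blast
qed

text \<open>The two sums are logarithms of moduli of monomials. Where the exponents differ,
  \<open>g k\<close> dominates every other \<open>g i\<close>, so the larger exponent at
  \<open>k\<close> decides the comparison by an unbounded margin.\<close>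

lemma monomial_dominance:
  fixes g :: "nat \<Rightarrow> 'a \<Rightarrow> real" and \<alpha> \<beta> :: "nat \<Rightarrow> nat"
  assumes uf: "ultrafilter \<omega>"
    and inf: "\<And>i C. i \<le> m \<Longrightarrow> \<forall>\<^sub>F n in \<omega>. C \<le> g i n"
    and k: "k \<le> m" "\<alpha> k < \<beta> k"
    and dom: "\<And>i C. i \<le> m \<Longrightarrow> \<alpha> i \<noteq> \<beta> i \<Longrightarrow> i \<noteq> k \<Longrightarrow> C > 0 \<Longrightarrow> \<forall>\<^sub>F n in \<omega>. C * g i n \<le> g k n"
  shows "\<forall>\<^sub>F n in \<omega>. (\<Sum>i\<le>m. real (\<alpha> i) * g i n) + K \<le> (\<Sum>i\<le>m. real (\<beta> i) * g i n)"
proof -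
  \<comment> \<open>Each of the at most \<open>m\<close> other indices can lose at most
    \<open>g k n / (2 * (m + 1))\<close>, together at most half of \<open>g k n\<close>, against a
    gain of at least \<open>g k n\<close> at \<open>k\<close>. The remaining half exceeds
    \<open>K\<close>. The \<open>+ 1\<close> keeps \<open>c i\<close> positive when \<alpha>
    vanishes at \<open>i\<close>.\<close>
  define c where "c = (\<lambda>i. 2 * (real m + 1) * (real (\<alpha> i) + 1))"
  have cpos: "c i > 0" for i by (simp add: c_def)
  have "\<forall>\<^sub>F n in \<omega>. \<forall>i\<in>{..m}. 0 \<le> g i n \<and> (\<alpha> i \<noteq> \<beta> i \<longrightarrow> i \<noteq> k \<longrightarrow> c i * g i n \<le> g k n)"
  proof (intro eventually_ball_finite ballI)
    fix i assume "i \<in> {..m}"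
    then have i: "i \<le> m" by simp
    show "\<forall>\<^sub>F n in \<omega>. 0 \<le> g i n \<and> (\<alpha> i \<noteq> \<beta> i \<longrightarrow> i \<noteq> k \<longrightarrow> c i * g i n \<le> g k n)"
    proof (cases "\<alpha> i \<noteq> \<beta> i \<and> i \<noteq> k")
      case True
      then show ?thesis using inf[OF i, of 0] dom[OF i _ _ cpos[of i]] by (auto intro: eventually_conj)
    next
      case False
      then show ?thesis using inf[OF i, of 0] by (auto elim: eventually_mono)
    qed
  qed simp
  moreover have "\<forall>\<^sub>F n in \<omega>. 2 * K \<le> g k n" by (rule inf[OF k(1)])
  ultimately show ?thesis
  proof eventually_elim
    case (elim n)
    have lk: "0 \<le> g k n" using elim k by auto
    have trm: "- (g k n / (2 * (real m + 1))) \<le> (real (\<beta> i) - real (\<alpha> i)) * g i n" if "i \<le> m" "i \<noteq> k" for i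
    proof (cases "\<alpha> i = \<beta> i")
      case True
      then show ?thesis using lk by simp
    next
      case False
      then have *: "2 * (real m + 1) * (real (\<alpha> i) + 1) * g i n \<le> g k n" and **: "0 \<le> g i n"
        using elim that by (auto simp: c_def)
      have "real (\<alpha> i) * g i n \<le> (real (\<alpha> i) + 1) * g i n"
        using ** by (intro mult_right_mono) auto
      also have "\<dots> \<le> g k n / (2 * (real m + 1))"
        using * by (simp add: pos_le_divide_eq mult_ac)
      finally have "real (\<alpha> i) * g i n \<le> g k n / (2 * (real m + 1))" .
      moreover have "0 \<le> real (\<beta> i) * g i n" using ** by simp
      ultimately show ?thesis by (simp only: left_diff_distrib)
    qed
    have "- (g k n / 2) \<le> real (card ({..m} - {k})) * (- (g k n / (2 * (real m + 1))))"
      using lk k by (simp add: field_simps)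
    also have "\<dots> \<le> (\<Sum>i\<in>{..m} - {k}. (real (\<beta> i) - real (\<alpha> i)) * g i n)"
      using trm by (intro sum_bounded_below) auto
    finally have 1: "- (g k n / 2) \<le> (\<Sum>i\<in>{..m} - {k}. (real (\<beta> i) - real (\<alpha> i)) * g i n)" .
    have "1 * g k n \<le> (real (\<beta> k) - real (\<alpha> k)) * g k n"
      using k(2) lk by (intro mult_right_mono) auto
    with 1 have "g k n / 2 \<le> (\<Sum>i\<le>m. (real (\<beta> i) - real (\<alpha> i)) * g i n)"
      using k(1) by (subst sum.remove[of _ k]) auto
    also have "\<dots> = (\<Sum>i\<le>m. real (\<beta> i) * g i n) - (\<Sum>i\<le>m. real (\<alpha> i) * g i n)"
      by (simp add: left_diff_distrib sum_subtractf)
    finally show ?case using elim(2) by linarith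
  qed
qed

text \<open>Constant coefficients shift the logarithms of the terms by fixed amounts, while the
  logarithms of distinct monomials drift apart without bound. The second condition on
  \<open>I\<close> says that exponents are determined by their values up to \<open>m\<close>, the
  only ones the monomials see.\<close>

lemma no_algebraic_relation:
  fixes x :: "nat \<Rightarrow> 'a \<Rightarrow> complex" and c :: "(nat \<Rightarrow> nat) \<Rightarrow> complex"
  assumes uf: "ultrafilter \<omega>"
    and inf: "\<And>i C. i \<le> m \<Longrightarrow> \<forall>\<^sub>F n in \<omega>. C \<le> ln (norm (x i n))"
    and sep: "\<And>i j. i \<le> m \<Longrightarrow> j \<le> m \<Longrightarrow> i \<noteq> j \<Longrightarrow>
      (\<forall>C>0. \<forall>\<^sub>F n in \<omega>. C * ln (norm (x i n)) \<le> ln (norm (x j n))) \<or>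
      (\<forall>C>0. \<forall>\<^sub>F n in \<omega>. C * ln (norm (x j n)) \<le> ln (norm (x i n)))"
    and I: "finite I" "\<And>\<alpha> \<beta>. \<alpha> \<in> I \<Longrightarrow> \<beta> \<in> I \<Longrightarrow> (\<And>i. i \<le> m \<Longrightarrow> \<alpha> i = \<beta> i) \<Longrightarrow> \<alpha> = \<beta>"
    and rel: "\<forall>\<^sub>F n in \<omega>. (\<Sum>\<alpha>\<in>I. c \<alpha> * (\<Prod>i\<le>m. x i n ^ \<alpha> i)) = 0"
    and "\<alpha> \<in> I"
  shows "c \<alpha> = 0"
proof (rule ccontr)
  assume nz: "c \<alpha> \<noteq> 0"
  define g where "g = (\<lambda>i n. ln (norm (x i n)))"
  define s where "s = (\<lambda>\<alpha> n. \<Sum>i\<le>m. real (\<alpha> i) * g i n)"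
  define U where "U = {\<alpha>\<in>I. c \<alpha> \<noteq> 0}"
  have U: "finite U" "U \<noteq> {}" using I(1) nz \<open>\<alpha> \<in> I\<close> by (auto simp: U_def)
  obtain \<beta> where \<beta>: "\<beta> \<in> U" "\<And>\<alpha>. \<alpha> \<in> U \<Longrightarrow> \<forall>\<^sub>F n in \<omega>. s \<alpha> n \<le> s \<beta> n"
    using ultrafilter_finite_max[OF uf U, of s] by blast
  have pos: "\<forall>\<^sub>F n in \<omega>. g i n > 0" if "i \<le> m" for i
    using inf[OF that, of 1] unfolding g_def by eventually_elim simp
  have sep_g: "(\<forall>C>0. \<forall>\<^sub>F n in \<omega>. C * g i n \<le> g j n) \<or> (\<forall>C>0. \<forall>\<^sub>F n in \<omega>. C * g j n \<le> g i n)"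
    if "i \<le> m" "j \<le> m" "i \<noteq> j" for i j
    using sep[OF that] by (simp add: g_def)
  have dom: "\<forall>\<^sub>F n in \<omega>. s \<alpha> n + K \<le> s \<beta> n" if \<alpha>: "\<alpha> \<in> U" "\<alpha> \<noteq> \<beta>" for \<alpha> K
  proof -
    define J where "J = {i. i \<le> m \<and> \<alpha> i \<noteq> \<beta> i}"
    have "J \<noteq> {}" using I(2)[of \<alpha> \<beta>] \<alpha> \<beta>(1) by (auto simp: J_def U_def)
    moreover have "J \<subseteq> {..m}" by (auto simp: J_def)
    ultimately obtain k where k: "k \<in> J"
      "\<And>i C. i \<in> J \<Longrightarrow> i \<noteq> k \<Longrightarrow> C > 0 \<Longrightarrow> \<forall>\<^sub>F n in \<omega>. C * g i n \<le> g k n"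
      using dominant_index[where g = g and m = m and J = J, OF uf pos sep_g] by blast
    have km: "k \<le> m" "\<alpha> k \<noteq> \<beta> k" using k(1) by (auto simp: J_def)
    show ?thesis
    proof (cases "\<alpha> k < \<beta> k")
      case True
      then show ?thesis
        unfolding s_def
        using monomial_dominance[OF uf, of m g k \<alpha> \<beta> K] inf k(2) km by (simp add: g_def J_def)
    next
      \<comment> \<open>A larger exponent of \<alpha> at the dominant index would make its monomial
        exceed the maximal one.\<close>
      case False
      then have "\<forall>\<^sub>F n in \<omega>. s \<beta> n + 1 \<le> s \<alpha> n"
        unfolding s_def
        using monomial_dominance[OF uf, of m g k \<beta> \<alpha> 1] inf k(2) km by (simp add: g_def J_def)
      then have "\<forall>\<^sub>F n in \<omega>. False" using \<beta>(2)[OF \<alpha>(1)] by eventually_elim simp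
      then show ?thesis by (auto elim: eventually_mono)
    qed
  qed
  \<comment> \<open>Twice the number of terms: each other term will be at most \<open>1 / N\<close>
    of the largest, so together they reach at most half of it. The logarithm added to
    \<open>s \<alpha> n\<close> below expresses exactly this bound.\<close>
  define N where "N = 2 * real (card U)"
  have N: "N > 0" using U by (simp add: N_def card_gt_0_iff)
  have c\<beta>: "norm (c \<beta>) > 0" using \<beta>(1) by (simp add: U_def)
  have "\<forall>\<^sub>F n in \<omega>. \<forall>\<alpha>\<in>U. \<alpha> \<noteq> \<beta> \<longrightarrow> s \<alpha> n + ln (N * norm (c \<alpha>) / norm (c \<beta>)) \<le> s \<beta> n"
  proof (intro eventually_ball_finite U(1) ballI)
    fix \<alpha> assume "\<alpha> \<in> U"
    then show "\<forall>\<^sub>F n in \<omega>. \<alpha> \<noteq> \<beta> \<longrightarrow> s \<alpha> n + ln (N * norm (c \<alpha>) / norm (c \<beta>)) \<le> s \<beta> n"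
      using dom[of \<alpha>] by (cases "\<alpha> = \<beta>") auto
  qed
  moreover have "\<forall>\<^sub>F n in \<omega>. \<forall>i\<in>{..m}. g i n > 0"
    using pos by (intro eventually_ball_finite) auto
  ultimately have "\<forall>\<^sub>F n in \<omega>. False"
    using rel
  proof eventually_elim
    case (elim n)
    have normp: "norm (\<Prod>i\<le>m. x i n ^ \<alpha> i) = exp (s \<alpha> n)" for \<alpha>
    proof -
      have "norm (x i n) ^ \<alpha> i = exp (real (\<alpha> i) * g i n)" if "i \<le> m" for i
      proof -
        have "g i n > 0" using elim that by auto
        \<comment> \<open>A positive logarithm excludes \<open>x i n = 0\<close>, since
          \<open>ln 0 = 0\<close>.\<close>
        then have "norm (x i n) > 0" unfolding g_def by (metis less_irrefl ln_0 norm_eq_zero zero_less_norm_iff)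
        then have "norm (x i n) = exp (g i n)" by (simp add: g_def)
        then show ?thesis by (simp add: exp_of_nat_mult)
      qed
      then show ?thesis by (simp add: s_def exp_sum norm_power flip: prod_norm)
    qed
    let ?t = "\<lambda>\<alpha>. c \<alpha> * (\<Prod>i\<le>m. x i n ^ \<alpha> i)"
    have small: "norm (?t \<alpha>) \<le> norm (c \<beta>) * exp (s \<beta> n) / N" if "\<alpha> \<in> U - {\<beta>}" for \<alpha>
    proof -
      have c\<alpha>: "norm (c \<alpha>) > 0" using that by (simp add: U_def)
      have "exp (s \<alpha> n + ln (N * norm (c \<alpha>) / norm (c \<beta>))) \<le> exp (s \<beta> n)"
        using elim(1) that by simp
      then have "exp (s \<alpha> n) * (N * norm (c \<alpha>) / norm (c \<beta>)) \<le> exp (s \<beta> n)"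
        using N c\<alpha> c\<beta> by (simp add: exp_add)
      then show ?thesis
        using N c\<beta> by (simp add: norm_mult normp field_simps)
    qed
    have "(\<Sum>\<alpha>\<in>U. ?t \<alpha>) = (\<Sum>\<alpha>\<in>I. ?t \<alpha>)"
      using I(1) by (intro sum.mono_neutral_left) (auto simp: U_def)
    then have "?t \<beta> + (\<Sum>\<alpha>\<in>U - {\<beta>}. ?t \<alpha>) = 0"
      using elim(3) sum.remove[OF U(1) \<beta>(1), of ?t] by simp
    then have "?t \<beta> = - (\<Sum>\<alpha>\<in>U - {\<beta>}. ?t \<alpha>)"
      by (simp only: eq_neg_iff_add_eq_0)
    then have "norm (?t \<beta>) = norm (\<Sum>\<alpha>\<in>U - {\<beta>}. ?t \<alpha>)"
      by (simp only: norm_minus_cancel)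
    also have "\<dots> \<le> real (card (U - {\<beta>})) * (norm (c \<beta>) * exp (s \<beta> n) / N)"
      using small by (intro sum_norm_bound)
    also have "\<dots> \<le> real (card U) * (norm (c \<beta>) * exp (s \<beta> n) / N)"
      using N U(1) by (intro mult_right_mono) (auto intro: card_mono)
    also have "\<dots> = norm (c \<beta>) * exp (s \<beta> n) / 2"
      using N by (simp add: N_def)
    also have "\<dots> < norm (c \<beta>) * exp (s \<beta> n)" using c\<beta> by simp
    finally show ?case by (simp add: norm_mult normp)
  qed
  then show False using uf by (simp add: ultrafilter_def)
qed

section \<open>Algebraicity of multipliers\<close>

text \<open>The degree bound common to all \<open>n\<close> makes evaluation and products finite
  sums of fixed length, to which closure of \<open>filtered_ring T\<close> applies.\<close>

definition poly_seq :: "(nat \<Rightarrow> ('a \<Rightarrow> complex) set) \<Rightarrow> ('a \<Rightarrow> complex poly) \<Rightarrow> bool" where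
  "poly_seq T P \<longleftrightarrow> (\<exists>D. \<forall>n. degree (P n) \<le> D) \<and> (\<forall>j. (\<lambda>n. coeff (P n) j) \<in> filtered_ring T)"

lemma poly_seq_mono: "filtered_ring T \<subseteq> filtered_ring T' \<Longrightarrow> poly_seq T P \<Longrightarrow> poly_seq T' P"
  by (auto simp: poly_seq_def)

lemma poly_seq_add:
  assumes "mono T" "poly_seq T P" "poly_seq T Q"
  shows "poly_seq T (\<lambda>n. P n + Q n)"
proof -
  obtain D E where "\<forall>n. degree (P n) \<le> D" "\<forall>n. degree (Q n) \<le> E"
    using assms by (auto simp: poly_seq_def)
  then have "\<forall>n. degree (P n + Q n) \<le> max D E"
    by (intro allI degree_add_le) (auto intro: max.coboundedI1 max.coboundedI2)
  moreover have "(\<lambda>n. coeff (P n + Q n) j) \<in> filtered_ring T" for j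
    using assms by (simp add: poly_seq_def filtered_ring_add_fun)
  ultimately show ?thesis by (auto simp: poly_seq_def)
qed

lemma poly_seq_mult:
  assumes "mono T" "poly_seq T P" "poly_seq T Q"
  shows "poly_seq T (\<lambda>n. P n * Q n)"
proof -
  obtain D E where "\<forall>n. degree (P n) \<le> D" "\<forall>n. degree (Q n) \<le> E"
    using assms by (auto simp: poly_seq_def)
  then have "\<forall>n. degree (P n * Q n) \<le> D + E"
    by (meson add_mono degree_mult_le order.trans)
  moreover have "(\<lambda>n. coeff (P n * Q n) j) \<in> filtered_ring T" for j
    unfolding coeff_mult
    using assms by (intro filtered_ring_sum_fun filtered_ring_mult_fun) (auto simp: poly_seq_def)
  ultimately show ?thesis by (auto simp: poly_seq_def)
qed

lemma poly_seq_const: "poly_seq T (\<lambda>_. p)"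
  using filtered_ring_const by (auto simp: poly_seq_def)

lemma poly_seq_smult:
  assumes "c \<in> filtered_ring T" "poly_seq T P"
  shows "poly_seq T (\<lambda>n. smult (c n) (P n))"
proof -
  obtain D where "\<forall>n. degree (P n) \<le> D" using assms by (auto simp: poly_seq_def)
  then have "\<forall>n. degree (smult (c n) (P n)) \<le> D" by (meson degree_smult_le order.trans)
  moreover have "(\<lambda>n. coeff (smult (c n) (P n)) j) \<in> filtered_ring T" for j
    using assms by (simp add: poly_seq_def filtered_ring_mult_fun)
  ultimately show ?thesis unfolding poly_seq_def by blast
qed

lemma poly_seq_diff:
  assumes "mono T" "poly_seq T P" "poly_seq T Q"
  shows "poly_seq T (\<lambda>n. P n - Q n)"
  using poly_seq_add[OF assms(1,2) poly_seq_smult[OF filtered_ring_const[of "- 1"] assms(3)]] by simp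

lemma poly_seq_power: "mono T \<Longrightarrow> poly_seq T P \<Longrightarrow> poly_seq T (\<lambda>n. P n ^ k)"
  by (induction k) (auto intro: poly_seq_const poly_seq_mult)

lemma poly_seq_sum:
  assumes "mono T" "\<And>i. i \<in> I \<Longrightarrow> poly_seq T (F i)"
  shows "poly_seq T (\<lambda>n. \<Sum>i\<in>I. F i n)"
  using assms(2)
  by (induction I rule: infinite_finite_induct) (auto intro: poly_seq_const poly_seq_add[OF assms(1)])

lemma poly_seq_pCons: "mono T \<Longrightarrow> poly_seq T P \<Longrightarrow> poly_seq T (\<lambda>n. pCons 0 (P n))"
  using poly_seq_mult[OF _ poly_seq_const[of T "[:0, 1:]"], of P] by simp

lemma poly_seq_pderiv:
  assumes "poly_seq T P"
  shows "poly_seq T (\<lambda>n. pderiv (P n))"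
proof -
  obtain D where "\<forall>n. degree (P n) \<le> D" using assms by (auto simp: poly_seq_def)
  then have "\<forall>n. degree (pderiv (P n)) \<le> D" by (metis degree_pderiv diff_le_self order.trans)
  moreover have "(\<lambda>n. coeff (pderiv (P n)) j) \<in> filtered_ring T" for j
    unfolding coeff_pderiv
    using assms by (intro filtered_ring_mult_fun filtered_ring_const) (auto simp: poly_seq_def)
  ultimately show ?thesis by (auto simp: poly_seq_def)
qed

lemma poly_seq_iterate:
  assumes "mono T" "poly_seq T P" "poly_seq T Q"
  shows "poly_seq T (\<lambda>n. num d (P n) (Q n) l) \<and> poly_seq T (\<lambda>n. den d (P n) (Q n) l)"
proof (induction l)
  case 0
  then show ?case by (simp add: poly_seq_const)
next
  case (Suc l)
  have "poly_seq T (\<lambda>n. hpoly d (R n) (num d (P n) (Q n) l) (den d (P n) (Q n) l))"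
    if "poly_seq T R" for R
    unfolding hpoly_def using that assms Suc
    by (intro poly_seq_sum poly_seq_smult poly_seq_mult poly_seq_power) (auto simp: poly_seq_def)
  then show ?case using assms by simp
qed

lemma poly_seq_reverse:
  assumes "poly_seq T P"
  shows "poly_seq T (\<lambda>n. reverse_poly d (P n))"
proof -
  have "(\<lambda>n. coeff (reverse_poly d (P n)) j) \<in> filtered_ring T" for j
    using assms filtered_ring_const[of 0 T]
    by (cases "j \<le> d") (auto simp: coeff_reverse_poly poly_seq_def)
  then show ?thesis using degree_reverse_poly by (auto simp: poly_seq_def)
qed

lemma poly_seq_eval:
  assumes "mono T" "poly_seq T P" "z \<in> fractions \<omega> T"
  shows "(\<lambda>n. poly (P n) (z n)) \<in> fractions \<omega> T"
proof -
  obtain D where D: "\<And>n. degree (P n) \<le> D" using assms by (auto simp: poly_seq_def)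
  have "(\<lambda>n. coeff (P n) i) \<in> fractions \<omega> T" for i
    using assms(2) filtered_ring_subset_fractions by (auto simp: poly_seq_def)
  then have "(\<lambda>n. \<Sum>i\<le>D. coeff (P n) i * z n ^ i) \<in> fractions \<omega> T"
    using assms by (intro fractions_sum fractions_mult fractions_power) auto
  moreover have "(\<lambda>n. \<Sum>i\<le>D. coeff (P n) i * z n ^ i) = (\<lambda>n. poly (P n) (z n))"
    using hform_one[OF D] by (simp add: hform_def)
  ultimately show ?thesis by simp
qed

lemma quot_deriv_fraction:
  assumes "mono T" "poly_seq T A" "poly_seq T B" "z \<in> fractions \<omega> T"
    and "\<forall>\<^sub>F n in \<omega>. poly (B n) (z n) \<noteq> 0"
  shows "(\<lambda>n. quot_deriv (A n) (B n) (z n)) \<in> fractions \<omega> T"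
proof -
  have "(\<lambda>n. poly (pderiv (A n) * B n - A n * pderiv (B n)) (z n)) \<in> fractions \<omega> T"
    using assms by (intro poly_seq_eval poly_seq_diff poly_seq_mult poly_seq_pderiv)
  moreover have "(\<lambda>n. poly (B n * B n) (z n)) \<in> fractions \<omega> T"
    using assms by (intro poly_seq_eval poly_seq_mult)
  moreover have "\<forall>\<^sub>F n in \<omega>. poly (B n * B n) (z n) \<noteq> 0"
    using assms(5) by eventually_elim simp
  ultimately have "(\<lambda>n. poly (pderiv (A n) * B n - A n * pderiv (B n)) (z n) / poly (B n * B n) (z n))
      \<in> fractions \<omega> T"
    by (rule fractions_divide)
  then show ?thesis by (simp add: quot_deriv_def)
qed


text \<open>The degree of \<open>P n\<close> may vary with \<open>n\<close>, but
  \<open>growth_adjoin_algebraic\<close> needs one degree with an almost surely nonzero leading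
  coefficient. The ultrafilter decides for each coefficient whether it vanishes, and
  \<open>D\<close> is the last one that does not.\<close>

lemma root_adjoin:
  assumes uf: "ultrafilter \<omega>" and G: "growth \<omega> m T" and P: "poly_seq T P"
    and nz: "\<And>n. P n \<noteq> 0" and root: "\<forall>\<^sub>F n in \<omega>. poly (P n) (z n) = 0"
  obtains T' where "growth \<omega> m T'" "filtered_ring T \<subseteq> filtered_ring T'" "z \<in> fractions \<omega> T'"
proof -
  have nbot: "\<omega> \<noteq> bot" using uf by (simp add: ultrafilter_def)
  obtain E where E: "\<And>n. degree (P n) \<le> E" using P by (auto simp: poly_seq_def)
  define S where "S = {j. j \<le> E \<and> (\<forall>\<^sub>F n in \<omega>. coeff (P n) j \<noteq> 0)}"
  have finS: "finite S" unfolding S_def by simp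
  have zero: "\<forall>\<^sub>F n in \<omega>. coeff (P n) j = 0" if "j \<notin> S" for j
  proof (cases "j \<le> E")
    case True
    then show ?thesis using that ultrafilter_cases[OF uf, of "\<lambda>n. coeff (P n) j \<noteq> 0"] by (auto simp: S_def)
  next
    case False
    then have "coeff (P n) j = 0" for n using E[of n] by (intro coeff_eq_0) simp
    then show ?thesis by simp
  qed
  have "S \<noteq> {}"
  proof
    assume "S = {}"
    then have "\<forall>\<^sub>F n in \<omega>. \<forall>j\<in>{..E}. coeff (P n) j = 0"
      using zero by (intro eventually_ball_finite) auto
    then have "\<forall>\<^sub>F n in \<omega>. False"
    proof eventually_elim
      case (elim n)
      then have "lead_coeff (P n) = 0" using E[of n] by simp
      then show ?case using nz[of n] by simp
    qed
    then show False using nbot by simp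
  qed
  define D where "D = Max S"
  have DS: "D \<in> S" using finS \<open>S \<noteq> {}\<close> by (simp add: D_def)
  have high: "\<forall>\<^sub>F n in \<omega>. \<forall>j\<in>{D<..E}. coeff (P n) j = 0"
  proof (intro eventually_ball_finite ballI)
    fix j assume j: "j \<in> {D<..E}"
    have "j \<notin> S"
    proof
      assume "j \<in> S"
      then have "j \<le> D" unfolding D_def by (rule Max_ge[OF finS])
      then show False using j by simp
    qed
    then show "\<forall>\<^sub>F n in \<omega>. coeff (P n) j = 0" by (rule zero)
  qed simp
  have rel: "\<forall>\<^sub>F n in \<omega>. (\<Sum>j\<le>D. coeff (P n) j * z n ^ j) = 0"
    using root high
  proof eventually_elim
    case (elim n)
    have "degree (P n) \<le> D"
      using elim(2) E by (intro degree_le) (metis coeff_eq_0 greaterThanAtMost_iff le_less_trans not_le)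
    then show ?case using elim(1) hform_one[of "P n" D "z n"] by (simp add: hform_def)
  qed
  have nzD: "\<forall>\<^sub>F n in \<omega>. coeff (P n) D \<noteq> 0" using DS by (simp add: S_def)
  \<comment> \<open>For \<open>D = 0\<close> the relation would say that an almost surely nonzero
    constant is 0.\<close>
  have "D > 0"
  proof (rule ccontr)
    assume "\<not> D > 0"
    then have D0: "D = 0" by simp
    have "\<forall>\<^sub>F n in \<omega>. False"
      using rel nzD
    proof eventually_elim
      case (elim n)
      then show ?case using D0 by simp
    qed
    then show False using nbot by simp
  qed
  then show thesis
    using growth_adjoin_algebraic[OF G, of D "\<lambda>j n. coeff (P n) j" z] P rel nzD that
    by (auto simp: poly_seq_def)
qed

text \<open>A finite fixed point of the iterate is a root of numerator minus \<open>z\<close> times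
  denominator; once it is adjoined, its multiplier is a rational expression in it and the
  coefficients. At infinity, the fixed point is 0 for the reversed map and nothing is adjoined.
  Either way the exponent \<open>m\<close> stays.\<close>

lemma multiplier_adjoin:
  assumes uf: "ultrafilter \<omega>" and G: "growth \<omega> m T" and P: "poly_seq T P" and Q: "poly_seq T Q"
    and nf: "\<And>n. normal_form d (P n) (Q n)" and d: "d \<ge> 2" and l: "l \<ge> 1"
    and fixp: "\<forall>\<^sub>F n in \<omega>. (rmap d (P n) (Q n) ^^ l) (x n) = x n"
  obtains T' where "growth \<omega> m T'" "filtered_ring T \<subseteq> filtered_ring T'"
    "(\<lambda>n. fixed_point_deriv (rmap d (P n) (Q n) ^^ l) (x n)) \<in> fractions \<omega> T'"
proof -
  have nd: "nondegenerate d (P n) (Q n)" for n using nf by (simp add: normal_form_def)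
  have mT: "mono T" using G by (rule growth_mono)
  consider "\<forall>\<^sub>F n in \<omega>. x n = None" | "\<forall>\<^sub>F n in \<omega>. x n \<noteq> None"
    using ultrafilter_cases[OF uf] by blast
  then show thesis
  proof cases
    case 1
    define A where "A = (\<lambda>n. num d (reverse_poly d (Q n)) (reverse_poly d (P n)) l)"
    define B where "B = (\<lambda>n. den d (reverse_poly d (Q n)) (reverse_poly d (P n)) l)"
    have ev: "\<forall>\<^sub>F n in \<omega>. poly (B n) 0 \<noteq> 0 \<and>
        quot_deriv (A n) (B n) 0 = fixed_point_deriv (rmap d (P n) (Q n) ^^ l) (x n)"
      using 1 fixp
    proof eventually_elim
      case (elim n)
      let ?g = "rmap d (reverse_poly d (Q n)) (reverse_poly d (P n)) ^^ l"
      have g: "?g = sphere_inversion \<circ> (rmap d (P n) (Q n) ^^ l) \<circ> sphere_inversion"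
        by (rule rmap_reverse_iterate[OF nd])
      have nd': "nondegenerate d (reverse_poly d (Q n)) (reverse_poly d (P n))"
        by (rule nondegenerate_reverse[OF nd])
      have 0: "?g (Some 0) = Some 0" using elim by (simp add: g sphere_inversion_def)
      have "fixed_point_deriv (rmap d (P n) (Q n) ^^ l) (x n) = fixed_point_deriv ?g (Some 0)"
        using elim by (simp add: fixed_point_deriv_def g)
      then show ?case
        using iterate_fixed(1)[OF nd' 0] fixed_point_deriv_iterate[OF nd' 0] by (simp add: A_def B_def)
    qed
    have "(\<lambda>n. quot_deriv (A n) (B n) ((\<lambda>_. 0) n)) \<in> fractions \<omega> T"
    proof (rule quot_deriv_fraction[OF mT])
      show "poly_seq T A" "poly_seq T B"
        unfolding A_def B_def
        using poly_seq_iterate[OF mT poly_seq_reverse[OF Q] poly_seq_reverse[OF P]] by auto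
      show "(\<lambda>_. 0) \<in> fractions \<omega> T" using filtered_ring_const filtered_ring_subset_fractions by blast
      show "\<forall>\<^sub>F n in \<omega>. poly (B n) 0 \<noteq> 0" using ev by eventually_elim simp
    qed
    then have "(\<lambda>n. fixed_point_deriv (rmap d (P n) (Q n) ^^ l) (x n)) \<in> fractions \<omega> T"
      by (rule fractions_cong) (use ev in eventually_elim, simp)
    then show thesis using that[OF G] by blast
  next
    case 2
    define z where "z = (\<lambda>n. the (x n))"
    define A where "A = (\<lambda>n. num d (P n) (Q n) l)"
    define B where "B = (\<lambda>n. den d (P n) (Q n) l)"
    have AB: "poly_seq T A" "poly_seq T B"
      unfolding A_def B_def using poly_seq_iterate[OF mT P Q] by auto
    have ev: "\<forall>\<^sub>F n in \<omega>. poly (B n) (z n) \<noteq> 0 \<and> poly (A n) (z n) = z n * poly (B n) (z n) \<and>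
        quot_deriv (A n) (B n) (z n) = fixed_point_deriv (rmap d (P n) (Q n) ^^ l) (x n)"
      using 2 fixp
    proof eventually_elim
      case (elim n)
      then have xn: "x n = Some (z n)" by (simp add: z_def)
      have "(rmap d (P n) (Q n) ^^ l) (Some (z n)) = Some (z n)" using elim xn by simp
      then show ?case
        using iterate_fixed[OF nd] fixed_point_deriv_iterate[OF nd] by (simp add: A_def B_def xn)
    qed
    have "\<forall>\<^sub>F n in \<omega>. poly (A n - pCons 0 (B n)) (z n) = 0"
      using ev by eventually_elim simp
    moreover have "A n - pCons 0 (B n) \<noteq> 0" for n
      unfolding A_def B_def by (rule fixed_point_equation_nonzero[OF nf d l])
    moreover have "poly_seq T (\<lambda>n. A n - pCons 0 (B n))"
      using AB by (intro poly_seq_diff poly_seq_pCons mT)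
    ultimately obtain T' where T': "growth \<omega> m T'" "filtered_ring T \<subseteq> filtered_ring T'" "z \<in> fractions \<omega> T'"
      using root_adjoin[OF uf G] by blast
    have "(\<lambda>n. quot_deriv (A n) (B n) (z n)) \<in> fractions \<omega> T'"
    proof (rule quot_deriv_fraction[OF growth_mono[OF T'(1)]])
      show "poly_seq T' A" "poly_seq T' B" using AB T'(2) poly_seq_mono by blast+
      show "z \<in> fractions \<omega> T'" by (rule T')
      show "\<forall>\<^sub>F n in \<omega>. poly (B n) (z n) \<noteq> 0" using ev by eventually_elim simp
    qed
    then have "(\<lambda>n. fixed_point_deriv (rmap d (P n) (Q n) ^^ l) (x n)) \<in> fractions \<omega> T'"
      by (rule fractions_cong) (use ev in eventually_elim, simp)
    then show thesis using that T' by blast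
  qed
qed

lemma multipliers_adjoin:
  fixes k :: nat
  assumes uf: "ultrafilter \<omega>" and G: "growth \<omega> m T" and P: "poly_seq T P" and Q: "poly_seq T Q"
    and nf: "\<And>n. normal_form d (P n) (Q n)" and d: "d \<ge> 2"
    and fixp: "\<And>i. i < k \<Longrightarrow> l i \<ge> 1 \<and> (\<forall>\<^sub>F n in \<omega>. (rmap d (P n) (Q n) ^^ l i) (x i n) = x i n)"
  shows "\<exists>T'. growth \<omega> m T' \<and> filtered_ring T \<subseteq> filtered_ring T' \<and>
    (\<forall>i<k. (\<lambda>n. fixed_point_deriv (rmap d (P n) (Q n) ^^ l i) (x i n)) \<in> fractions \<omega> T')"
  using fixp
proof (induction k)
  case 0
  then show ?case using G by blast
next
  case (Suc k)
  then obtain T1 where T1: "growth \<omega> m T1" "filtered_ring T \<subseteq> filtered_ring T1"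
    "\<forall>i<k. (\<lambda>n. fixed_point_deriv (rmap d (P n) (Q n) ^^ l i) (x i n)) \<in> fractions \<omega> T1"
    by (meson less_SucI)
  have "l k \<ge> 1" "\<forall>\<^sub>F n in \<omega>. (rmap d (P n) (Q n) ^^ l k) (x k n) = x k n"
    using Suc.prems[of k] by auto
  then obtain T2 where T2: "growth \<omega> m T2" "filtered_ring T1 \<subseteq> filtered_ring T2"
    "(\<lambda>n. fixed_point_deriv (rmap d (P n) (Q n) ^^ l k) (x k n)) \<in> fractions \<omega> T2"
    using multiplier_adjoin[OF uf T1(1) poly_seq_mono[OF T1(2) P] poly_seq_mono[OF T1(2) Q] nf d]
    by blast
  have "\<forall>i<Suc k. (\<lambda>n. fixed_point_deriv (rmap d (P n) (Q n) ^^ l i) (x i n)) \<in> fractions \<omega> T2"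
    using T1(3) T2(3) fractions_mono[OF T2(2)] by (auto simp: less_Suc_eq)
  then show ?case using T1(2) T2(1,2) by blast
qed

text \<open>The parameters adjoined are whole sequences of coefficients, so the same kind of normal
  form must hold at every index.\<close>

lemma normal_form_parameters:
  assumes nf: "\<And>n. normal_form d (P n) (Q n)" and d: "d \<ge> 2"
    and cases: "(\<forall>n. Q n = 1) \<or> (\<forall>n. coeff (Q n) 0 = 0 \<and> coeff (P n) 0 = 1)"
  shows "\<exists>T. growth \<omega> (2 * d - 2) T \<and> poly_seq T P \<and> poly_seq T Q"
proof -
  have deg: "degree (P n) \<le> d" "degree (Q n) \<le> d" and lead: "coeff (P n) d = 1" "coeff (Q n) d = 0" for n
    using nf[of n] by (auto simp: normal_form_def nondegenerate_def)
  have high: "coeff (P n) j = 0" "coeff (Q n) j = 0" if "j > d" for n j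
    using that deg[of n] by (auto intro!: coeff_eq_0)
  show ?thesis
  proof (cases "\<forall>n. Q n = 1")
    case True
    define ts where "ts = map (\<lambda>j n. coeff (P n) j) [0..<d]"
    obtain T where T: "growth \<omega> (length ts) T" "set ts \<subseteq> filtered_ring T"
      using growth_adjoin_list by blast
    have "(\<lambda>n. coeff (P n) j) \<in> filtered_ring T" for j
    proof -
      consider "j < d" | "j = d" | "j > d" by linarith
      then show ?thesis
      proof cases
        case 1
        then have "(\<lambda>n. coeff (P n) j) \<in> set ts" by (auto simp: ts_def)
        then show ?thesis using T(2) by blast
      qed (use filtered_ring_const[of 1 T] filtered_ring_const[of 0 T] lead high in auto)
    qed
    then have "poly_seq T P" using deg by (auto simp: poly_seq_def)
    moreover have "Q = (\<lambda>_. 1)" using True by auto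
    then have "poly_seq T Q" by (simp only: poly_seq_const)
    moreover have "growth \<omega> (2 * d - 2) T"
      \<comment> \<open>The \<open>d\<close> free coefficients number at most
        \<open>2 * d - 2\<close> because \<open>d \<ge> 2\<close>.\<close>
      using d by (intro growth_weaken[OF T(1)]) (simp add: ts_def)
    ultimately show ?thesis by blast
  next
    case False
    then have zero: "coeff (Q n) 0 = 0" "coeff (P n) 0 = 1" for n using cases by auto
    define ts where "ts = map (\<lambda>j n. coeff (P n) j) [1..<d] @ map (\<lambda>j n. coeff (Q n) j) [1..<d]"
    obtain T where T: "growth \<omega> (length ts) T" "set ts \<subseteq> filtered_ring T"
      using growth_adjoin_list by blast
    have "(\<lambda>n. coeff (P n) j) \<in> filtered_ring T \<and> (\<lambda>n. coeff (Q n) j) \<in> filtered_ring T" for j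
    proof -
      consider "j = 0" | "1 \<le> j \<and> j < d" | "j = d" | "j > d" by linarith
      then show ?thesis
      proof cases
        case 2
        then have "(\<lambda>n. coeff (P n) j) \<in> set ts \<and> (\<lambda>n. coeff (Q n) j) \<in> set ts"
          by (auto simp: ts_def)
        then show ?thesis using T(2) by blast
      qed (use filtered_ring_const[of 1 T] filtered_ring_const[of 0 T] lead high zero in auto)
    qed
    then have "poly_seq T P" "poly_seq T Q" using deg by (auto simp: poly_seq_def)
    moreover have "length ts = 2 * d - 2" using d by (simp add: ts_def)
    ultimately show ?thesis using T(1) by metis
  qed
qed

section \<open>From multiplier scales to relations between multipliers\<close>

lemma period_dvd_fixed:
  assumes "periodic_point g x" "period g x dvd l"
  shows "(g ^^ l) x = x"
proof -
  have "\<exists>k. k > 0 \<and> (g ^^ k) x = x" using assms(1) by (auto simp: periodic_point_def)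
  then have per: "(g ^^ period g x) x = x"
    unfolding period_def by (rule LeastI2_ex) simp
  obtain k where k: "l = period g x * k" using assms(2) by (rule dvdE)
  have "((g ^^ period g x) ^^ k) x = x" by (induction k) (simp_all add: per)
  then show ?thesis by (simp add: k funpow_mult)
qed

lemma multiplier_scales_obtain:
  assumes "s \<in> multiplier_scales \<omega> f"
  obtains l p where "l \<ge> 1" "\<forall>n. (f n ^^ l) (p n) = p n" "s = scale_of \<omega> (multiplier_scale_seq f l p)"
proof -
  obtain l P where lP: "s = multiplier_scale \<omega> f l P" "l \<ge> 1" "P \<in> periodic_classes \<omega> f l"
    using assms by (auto simp: multiplier_scales_def)
  have "P \<noteq> {}" "P \<subseteq> periodic_seqs f l"
    using lP(3) in_quotient_imp_non_empty[OF equiv_ae_eq_rel] in_quotient_imp_subset[OF equiv_ae_eq_rel]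
    unfolding periodic_classes_def by blast+
  then obtain p where p: "p \<in> P" "p \<in> periodic_seqs f l" by blast
  then have "\<forall>n. (f n ^^ l) (p n) = p n"
    by (auto intro!: period_dvd_fixed simp: periodic_seqs_def)
  then show thesis
    using that lP multiplier_scale_class[OF lP(3) p(1)] by blast
qed

lemma Rat_normal_form:
  assumes "f \<in> Rat d" "d \<ge> 2"
  obtains P Q \<phi> where "normal_form d P Q" "\<And>l x. (f ^^ l) x = x \<Longrightarrow>
    (rmap d P Q ^^ l) (\<phi> x) = \<phi> x \<and> fixed_point_deriv (rmap d P Q ^^ l) (\<phi> x) = fixed_point_deriv (f ^^ l) x"
proof -
  obtain p q where pq: "nondegenerate d p q" "f = rmap d p q" using assms(1) by (rule Rat_obtain)
  obtain P Q where "normal_form d P Q" "same_multipliers d p q P Q"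
    using exists_normal_form[OF pq(1) assms(2)] by blast
  then show thesis using that unfolding same_multipliers_def pq(2) by blast
qed

text \<open>Indices run from 0, so these are \<open>2 * d - 1\<close> multipliers, one more than
  there are parameters. Normal forms are chosen separately for each \<open>n\<close>; this is
  harmless because conjugation preserves every multiplier involved.\<close>

lemma multipliers_dependent:
  assumes uf: "ultrafilter \<omega>" and d: "d \<ge> 2" and f: "\<And>n. f n \<in> Rat d"
    and l: "\<And>i. i \<le> 2 * d - 2 \<Longrightarrow> l i \<ge> 1"
    and p: "\<And>i n. i \<le> 2 * d - 2 \<Longrightarrow> (f n ^^ l i) (p i n) = p i n"
  obtains M c where "\<exists>\<alpha>\<in>PiE {..2 * d - 2} (\<lambda>_. {..M}). c \<alpha> \<noteq> 0"
    "\<forall>\<^sub>F n in \<omega>. (\<Sum>\<alpha>\<in>PiE {..2 * d - 2} (\<lambda>_. {..M}). c \<alpha> *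
       (\<Prod>i\<le>2 * d - 2. fixed_point_deriv (f n ^^ l i) (p i n) ^ \<alpha> i)) = 0"
proof -
  define m where "m = 2 * d - 2"
  have nbot: "\<omega> \<noteq> bot" using uf by (simp add: ultrafilter_def)
  have "\<exists>P Q \<phi>. normal_form d P Q \<and> (\<forall>l x. (f n ^^ l) x = x \<longrightarrow>
    (rmap d P Q ^^ l) (\<phi> x) = \<phi> x \<and>
    fixed_point_deriv (rmap d P Q ^^ l) (\<phi> x) = fixed_point_deriv (f n ^^ l) x)" for n
    using Rat_normal_form[OF f d, of n] by metis
  then obtain P0 Q0 \<phi> where nf0: "\<And>n. normal_form d (P0 n) (Q0 n)"
    and \<phi>: "\<And>n l x. (f n ^^ l) x = x \<Longrightarrow> (rmap d (P0 n) (Q0 n) ^^ l) (\<phi> n x) = \<phi> n x \<and>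
      fixed_point_deriv (rmap d (P0 n) (Q0 n) ^^ l) (\<phi> n x) = fixed_point_deriv (f n ^^ l) x"
    by metis
  \<comment> \<open>The ultrafilter selects one of the two kinds of normal form on a set of full
    measure.\<close>
  obtain R where R: "\<forall>\<^sub>F n in \<omega>. R n"
    and cases: "(\<forall>n. R n \<longrightarrow> Q0 n = 1) \<or> (\<forall>n. R n \<longrightarrow> coeff (Q0 n) 0 = 0 \<and> coeff (P0 n) 0 = 1)"
  proof (cases "\<forall>\<^sub>F n in \<omega>. Q0 n = 1")
    case True
    then show thesis by (rule that) simp
  next
    case False
    then have "\<forall>\<^sub>F n in \<omega>. Q0 n \<noteq> 1" using ultrafilter_cases[OF uf] by blast
    then show thesis by (rule that) (use nf0 in \<open>auto simp: normal_form_def\<close>)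
  qed
  obtain n0 where n0: "R n0" using eventually_happens'[OF nbot R] by blast
  \<comment> \<open>changing the maps on a null set makes one kind of normal form hold for every index\<close>
  define P where "P = (\<lambda>n. if R n then P0 n else P0 n0)"
  define Q where "Q = (\<lambda>n. if R n then Q0 n else Q0 n0)"
  have nf: "normal_form d (P n) (Q n)" for n using nf0 by (simp add: P_def Q_def)
  have "(\<forall>n. Q n = 1) \<or> (\<forall>n. coeff (Q n) 0 = 0 \<and> coeff (P n) 0 = 1)"
    using cases n0 by (auto simp: P_def Q_def)
  then obtain T where T: "growth \<omega> m T" "poly_seq T P" "poly_seq T Q"
    using normal_form_parameters[where P = P and Q = Q and d = d and \<omega> = \<omega>] nf d unfolding m_def by blast
  have "\<forall>\<^sub>F n in \<omega>. (rmap d (P n) (Q n) ^^ l i) (\<phi> n (p i n)) = \<phi> n (p i n)" if "i \<le> m" for i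
    using R by eventually_elim (use \<phi> p that in \<open>simp add: P_def Q_def m_def\<close>)
  then obtain T' where T': "growth \<omega> m T'"
    "\<And>i. i < Suc m \<Longrightarrow> (\<lambda>n. fixed_point_deriv (rmap d (P n) (Q n) ^^ l i) (\<phi> n (p i n))) \<in> fractions \<omega> T'"
    using multipliers_adjoin[OF uf T nf d, of "Suc m" l "\<lambda>i n. \<phi> n (p i n)"] l
    by (auto simp: m_def less_Suc_eq_le)
  have "(\<lambda>n. fixed_point_deriv (f n ^^ l i) (p i n)) \<in> fractions \<omega> T'" if "i \<le> m" for i
  proof (rule fractions_cong[OF T'(2)])
    show "i < Suc m" using that by simp
    show "\<forall>\<^sub>F n in \<omega>. fixed_point_deriv (rmap d (P n) (Q n) ^^ l i) (\<phi> n (p i n)) =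
        fixed_point_deriv (f n ^^ l i) (p i n)"
      using R by eventually_elim (use \<phi> p that in \<open>simp add: P_def Q_def m_def\<close>)
  qed
  then show thesis
    using algebraic_dependence[OF T'(1), of "\<lambda>i n. fixed_point_deriv (f n ^^ l i) (p i n)"] that
    unfolding m_def by blast
qed

section \<open>Orders of growth encoded by multiplier scales\<close>

lemma one_in_scale_seqs: "(\<lambda>_. 1) \<in> scale_seqs"
  by (simp add: scale_seqs_def)

lemma multiplier_scale_seq_eq:
  "multiplier_scale_seq f l p n = 1 / (1 + log_plus (norm (fixed_point_deriv (f n ^^ l) (p n))) / real l)"
  by (simp add: multiplier_scale_seq_def multiplier_exponent_def)

lemma nontrivial_scale_unbounded:
  assumes uf: "ultrafilter \<omega>" and l: "l \<ge> 1"
    and ne: "scale_of \<omega> (multiplier_scale_seq f l p) \<noteq> trivial_scale \<omega>"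
  shows "\<forall>\<^sub>F n in \<omega>. C \<le> ln (norm (fixed_point_deriv (f n ^^ l) (p n)))"
proof -
  \<comment> \<open>Of the surplus 2, one unit pays for the 1 in the denominator of the scale; the
    other makes \<open>log_plus\<close> positive, so that it equals the logarithm.\<close>
  have "\<forall>\<^sub>F n in \<omega>. (\<bar>C\<bar> + 2) * multiplier_scale_seq f l p n \<le> 1"
  proof (rule scale_dominance[OF uf multiplier_scale_seq_in one_in_scale_seqs])
    show "scale_of \<omega> (multiplier_scale_seq f l p) \<noteq> scale_of \<omega> (\<lambda>_. 1)"
      using ne by (simp add: trivial_scale_def)
    have "multiplier_scale_seq f l p n \<le> 1" for n
      using multiplier_scale_seq_in[of f l p] by (simp add: scale_seqs_def)
    then show "\<forall>\<^sub>F n in \<omega>. multiplier_scale_seq f l p n \<le> 1" by simp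
  qed simp
  then show ?thesis
  proof eventually_elim
    case (elim n)
    define L where "L = log_plus (norm (fixed_point_deriv (f n ^^ l) (p n)))"
    have L0: "L \<ge> 0" by (simp add: L_def log_plus_def)
    then have "1 + L / real l > 0" by (simp add: add_pos_nonneg)
    then have "\<bar>C\<bar> + 2 \<le> 1 + L / real l"
      using elim by (simp add: multiplier_scale_seq_eq L_def[symmetric] field_simps)
    moreover have "L / real l \<le> L" using L0 l by (simp add: divide_le_eq mult_le_cancel_left1)
    ultimately have "\<bar>C\<bar> + 1 \<le> L" by linarith
    then show ?case unfolding L_def log_plus_def by linarith
  qed
qed

text \<open>The smaller scale belongs to the larger multiplier, so the inequality is reversed in
  passing to logarithms.\<close>

lemma distinct_scales_dominance:
  assumes uf: "ultrafilter \<omega>" and l: "l \<ge> 1" "l' \<ge> 1"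
    and nt: "scale_of \<omega> (multiplier_scale_seq f l p) \<noteq> trivial_scale \<omega>"
      "scale_of \<omega> (multiplier_scale_seq f l' p') \<noteq> trivial_scale \<omega>"
    and ne: "scale_of \<omega> (multiplier_scale_seq f l p) \<noteq> scale_of \<omega> (multiplier_scale_seq f l' p')"
    and le: "\<forall>\<^sub>F n in \<omega>. multiplier_scale_seq f l p n \<le> multiplier_scale_seq f l' p' n"
    and C: "C > 0"
  shows "\<forall>\<^sub>F n in \<omega>. C * ln (norm (fixed_point_deriv (f n ^^ l') (p' n)))
    \<le> ln (norm (fixed_point_deriv (f n ^^ l) (p n)))"
proof -
  \<comment> \<open>The factor \<open>real l'\<close> undoes the division in the exponent, and
    \<open>+ 1\<close> gives \<open>D \<ge> 1\<close>, which absorbs the 1 left in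
    \<open>1 + a / real l\<close>.\<close>
  define D where "D = C * real l' + 1"
  have D: "D > 0" using C by (simp add: D_def add_nonneg_pos)
  have "\<forall>\<^sub>F n in \<omega>. D * multiplier_scale_seq f l p n \<le> multiplier_scale_seq f l' p' n"
    by (rule scale_dominance[OF uf multiplier_scale_seq_in multiplier_scale_seq_in ne le D])
  then show ?thesis
    using nontrivial_scale_unbounded[OF uf l(1) nt(1), of 0] nontrivial_scale_unbounded[OF uf l(2) nt(2), of 0]
  proof eventually_elim
    case (elim n)
    define a where "a = ln (norm (fixed_point_deriv (f n ^^ l) (p n)))"
    define b where "b = ln (norm (fixed_point_deriv (f n ^^ l') (p' n)))"
    have a0: "a \<ge> 0" and b0: "b \<ge> 0" using elim by (auto simp: a_def b_def)
    have ea: "multiplier_scale_seq f l p n = 1 / (1 + a / real l)"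
      using a0 by (simp add: multiplier_scale_seq_eq log_plus_def a_def max_def)
    have eb: "multiplier_scale_seq f l' p' n = 1 / (1 + b / real l')"
      using b0 by (simp add: multiplier_scale_seq_eq log_plus_def b_def max_def)
    have pos: "1 + a / real l > 0" "1 + b / real l' > 0"
      using a0 b0 by (simp_all add: add_pos_nonneg)
    have "D / (1 + a / real l) \<le> 1 / (1 + b / real l')" using elim(1) by (simp add: ea eb)
    then have "D * (1 + b / real l') \<le> 1 + a / real l"
      using pos by (simp add: divide_le_eq le_divide_eq mult.commute)
    moreover have "D * (1 + b / real l') = D + C * b + b / real l'"
      using l by (simp add: D_def field_simps)
    moreover have "D \<ge> 1" using C by (simp add: D_def)
    moreover have "b / real l' \<ge> 0" using b0 by simp
    moreover have "a / real l \<le> a" using a0 l by (simp add: divide_le_eq mult_le_cancel_left1)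
    ultimately show ?case by (simp add: a_def[symmetric] b_def[symmetric])
  qed
qed

theorem theorem1p2:
  fixes d :: nat and \<omega> :: "nat filter" and f :: "nat \<Rightarrow> riemann_sphere \<Rightarrow> riemann_sphere"
  assumes "d \<ge> 2"
    and "nonprincipal_ultrafilter \<omega>"
    and "\<And>n. f n \<in> Rat d"
    and "degenerates d f"
  shows "finite (multiplier_scales \<omega> f - {trivial_scale \<omega>}) \<and>
         card (multiplier_scales \<omega> f - {trivial_scale \<omega>}) \<le> 2 * d - 2 \<and>
         finite (multiplier_scales \<omega> f) \<and>
         card (multiplier_scales \<omega> f) \<le> 2 * d - 1"
proof -
  let ?m = "2 * d - 2"
  let ?S = "multiplier_scales \<omega> f - {trivial_scale \<omega>}"
  have uf: "ultrafilter \<omega>" using assms(2) by (simp add: nonprincipal_ultrafilter_def)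
  \<comment> \<open>Bounding all finite subsets yields the finiteness of the set together with the
    bound on its cardinality.\<close>
  have "card F \<le> ?m" if F: "F \<subseteq> ?S" "finite F" for F
  proof (rule ccontr)
    assume "\<not> card F \<le> ?m"
    then obtain G where G: "G \<subseteq> F" "card G = Suc ?m" "finite G"
      by (metis not_less_eq_eq obtain_subset_with_card_n)
    then obtain h where h: "bij_betw h {0..<Suc ?m} G" using ex_bij_betw_nat_finite[OF G(3)] by metis
    have hS: "h i \<in> ?S" if "i \<le> ?m" for i
    proof -
      have "h i \<in> G" using bij_betwE[OF h] that by (simp add: less_Suc_eq_le)
      then show ?thesis using G(1) F(1) by blast
    qed
    have "\<exists>lp. i \<le> ?m \<longrightarrow> fst lp \<ge> 1 \<and> (\<forall>n. (f n ^^ fst lp) (snd lp n) = snd lp n) \<and>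
        h i = scale_of \<omega> (multiplier_scale_seq f (fst lp) (snd lp))" for i
    proof (cases "i \<le> ?m")
      case True
      then have "h i \<in> multiplier_scales \<omega> f" using hS by blast
      then obtain l p where "l \<ge> 1" "\<forall>n. (f n ^^ l) (p n) = p n"
        "h i = scale_of \<omega> (multiplier_scale_seq f l p)"
        by (rule multiplier_scales_obtain)
      then show ?thesis by (intro exI[of _ "(l, p)"]) simp
    qed simp
    then have "\<forall>i. \<exists>lp. i \<le> ?m \<longrightarrow> fst lp \<ge> 1 \<and> (\<forall>n. (f n ^^ fst lp) (snd lp n) = snd lp n) \<and>
        h i = scale_of \<omega> (multiplier_scale_seq f (fst lp) (snd lp))" by (rule allI)
    from choice[OF this] obtain q where
      q: "\<And>i. i \<le> ?m \<Longrightarrow> fst (q i) \<ge> 1 \<and> (\<forall>n. (f n ^^ fst (q i)) (snd (q i) n) = snd (q i) n) \<and>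
        h i = scale_of \<omega> (multiplier_scale_seq f (fst (q i)) (snd (q i)))" by blast
    define l where "l = (\<lambda>i. fst (q i))"
    define p where "p = (\<lambda>i. snd (q i))"
    have lp: "\<And>i. i \<le> ?m \<Longrightarrow> l i \<ge> 1"
      "\<And>i n. i \<le> ?m \<Longrightarrow> (f n ^^ l i) (p i n) = p i n"
      "\<And>i. i \<le> ?m \<Longrightarrow> h i = scale_of \<omega> (multiplier_scale_seq f (l i) (p i))"
      using q by (auto simp: l_def p_def)
    define x where "x = (\<lambda>i n. fixed_point_deriv (f n ^^ l i) (p i n))"
    obtain M c where c: "\<exists>\<alpha>\<in>PiE {..?m} (\<lambda>_. {..M}). c \<alpha> \<noteq> 0"
      "\<forall>\<^sub>F n in \<omega>. (\<Sum>\<alpha>\<in>PiE {..?m} (\<lambda>_. {..M}). c \<alpha> * (\<Prod>i\<le>?m. x i n ^ \<alpha> i)) = 0"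
      using multipliers_dependent[where f = f and l = l and p = p, OF uf assms(1,3) lp(1,2)] unfolding x_def by blast
    have nt: "scale_of \<omega> (multiplier_scale_seq f (l i) (p i)) \<noteq> trivial_scale \<omega>" if "i \<le> ?m" for i
      using hS[OF that] lp(3)[OF that] by auto
    have ne: "scale_of \<omega> (multiplier_scale_seq f (l i) (p i)) \<noteq> scale_of \<omega> (multiplier_scale_seq f (l j) (p j))"
      if "i \<le> ?m" "j \<le> ?m" "i \<noteq> j" for i j
    proof -
      have "h i \<noteq> h j"
        using h that by (auto simp: bij_betw_def inj_on_def)
      then show ?thesis using lp(3) that by simp
    qed
    have "c \<alpha> = 0" if "\<alpha> \<in> PiE {..?m} (\<lambda>_. {..M})" for \<alpha>
    proof (rule no_algebraic_relation[OF uf _ _ _ _ c(2) that])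
      show "\<forall>\<^sub>F n in \<omega>. C \<le> ln (norm (x i n))" if "i \<le> ?m" for i C
        unfolding x_def by (rule nontrivial_scale_unbounded[OF uf lp(1)[OF that] nt[OF that]])
      show "(\<forall>C>0. \<forall>\<^sub>F n in \<omega>. C * ln (norm (x i n)) \<le> ln (norm (x j n))) \<or>
        (\<forall>C>0. \<forall>\<^sub>F n in \<omega>. C * ln (norm (x j n)) \<le> ln (norm (x i n)))"
        if ij: "i \<le> ?m" "j \<le> ?m" "i \<noteq> j" for i j
      proof (cases "\<forall>\<^sub>F n in \<omega>. multiplier_scale_seq f (l i) (p i) n \<le> multiplier_scale_seq f (l j) (p j) n")
        case True
        show ?thesis
          unfolding x_def
          by (intro disjI2 allI impI distinct_scales_dominance[OF uf lp(1)[OF ij(1)] lp(1)[OF ij(2)]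
              nt[OF ij(1)] nt[OF ij(2)] ne[OF ij] True])
      next
        case False
        then have "\<forall>\<^sub>F n in \<omega>. multiplier_scale_seq f (l j) (p j) n \<le> multiplier_scale_seq f (l i) (p i) n"
          using ultrafilter_cases[OF uf, of "\<lambda>n. multiplier_scale_seq f (l i) (p i) n \<le> multiplier_scale_seq f (l j) (p j) n"]
          by (auto elim: eventually_mono)
        then show ?thesis
          unfolding x_def
          by (intro disjI1 allI impI distinct_scales_dominance[OF uf lp(1)[OF ij(2)] lp(1)[OF ij(1)]
              nt[OF ij(2)] nt[OF ij(1)] ne[OF ij(2,1) ij(3)[symmetric]]])
      qed
      show "finite (PiE {..?m} (\<lambda>_. {..M}))" by (intro finite_PiE) auto
      show "\<alpha> = \<beta>" if "\<alpha> \<in> PiE {..?m} (\<lambda>_. {..M})" "\<beta> \<in> PiE {..?m} (\<lambda>_. {..M})"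
        "\<And>i. i \<le> ?m \<Longrightarrow> \<alpha> i = \<beta> i" for \<alpha> \<beta>
        \<comment> \<open>Extensional functions on \<open>{..?m}\<close> agree once they agree
          there.\<close>
        using that by (intro PiE_ext) auto
    qed
    then show False using c(1) by blast
  qed
  then have S: "finite ?S \<and> card ?S \<le> ?m"
    by (intro finite_if_finite_subsets_card_bdd) auto
  have sub: "multiplier_scales \<omega> f \<subseteq> insert (trivial_scale \<omega>) ?S" by blast
  have "card (multiplier_scales \<omega> f) \<le> card (insert (trivial_scale \<omega>) ?S)"
    using S by (intro card_mono sub) simp
  also have "\<dots> \<le> Suc (card ?S)" by (rule card_insert_le_m1) (use S in auto)
  also have "\<dots> \<le> 2 * d - 1" using S assms(1) by linarith
  finally show ?thesis using S finite_subset[OF sub] by simp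
qed

end
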